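(* A subnormed topological pseudovector group $G$ is of class $\mathcal{O}_{00}$ if and only if it may be enlarged to a subnormed pseudovector group $\widetilde{G}$ such that $\mathcal{E}(\widetilde G)$ is dense in $\widetilde G$. Moreover, if $r\in\{1,\infty\}$, $N\in\{0,2,3,\ldots\}$ and $G$ (as a valued group) belongs to $\mathfrak{G}_r(N)$ and is of class $\mathcal{O}_{00}$, then $\widetilde G$ may be chosen so that $\widetilde G\in\mathfrak{G}_r(N)$.
   Context: A pseudovector group is $(G,+,* )$ with $(G,+)$ Abelian and $*\colon[0,\infty)\times G\to G$ an action with $0*x=0$, $1*x=x$, $(st)*x=s*(t*x)$, and $x\mapsto t*x$ a homomorphism for each $t\geqslant0$. A value on $G$ is $p\colon G\to[0,\infty)$ with $p(x)=0\iff x=0$, $p(-x)=p(x)$, $p(x+y)\leqslant p(x)+p(y)$; it induces the metric $p(x-y)$. A subnorm is a value with $\|t*x\|\leqslant\max(t,1)\|x\|$ for all $t\geqslant0$; a subnormed topological pseudovector group is one where $*$ is continuous w.r.t. the subnorm topology. For a subnorm, $\|g\|_{*0}:=\lim_{t\to\infty}\|t*g\|/t$ (exists). $G$ is of class $\mathcal{O}_{00}$ if for every $g\in G$, $\lim_{t\to\infty}\|t*g\|/t=\lim_{n\to\infty}\|ng\|/n=0$. For $A\subseteq G$, $\mathrm{lin}\,A=\{\sum_{j=1}^n t_j*a_j: n\geqslant1, t_j\geqslant0, a_j\in A\cup(-A)\cup\{0\}\}$. An element $a$ is Lipschitz if $[0,\infty)\ni t\mapsto t*a\in G$ is Lipschitz,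 bounded if $\mathrm{lin}\{a\}$ is a metrically bounded subset of $G$; $\mathcal{E}(G)$ is the set of elements of $G$ of finite order which are both Lipschitz and bounded. Enlarging means $G\subseteq\widetilde G$ with addition, action and subnorm extended. Class $\mathcal{O}_0$: $\lim_n p(na)/n=0$ for all $a$; $\mathfrak{G}_r(N)$: separable valued Abelian groups of class $\mathcal{O}_0$ with $p\leqslant r$ (vacuous if $r=\infty$) and of exponent $N$ if $N\neq0$. *)

theory Defs
  imports Complex_Main "HOL-Library.Countable_Set" "HOL-Library.Extended_Real"
begin

text \<open>A (pseudovector) group given explicitly by carrier and operations.
  The action is only meaningful for t \<ge> 0.\<close>
record 'a pvg =
  pv_carrier :: "'a set"
  pv_add :: "'a \<Rightarrow> 'a \<Rightarrow> 'a"
  pv_neg :: "'a \<Rightarrow> 'a"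
  pv_zero :: "'a"
  pv_act :: "real \<Rightarrow> 'a \<Rightarrow> 'a"
  pv_norm :: "'a \<Rightarrow> real"

definition pv_dist :: "('a, 'b) pvg_scheme \<Rightarrow> 'a \<Rightarrow> 'a \<Rightarrow> real" where
  "pv_dist G x y = pv_norm G (pv_add G x (pv_neg G y))"

definition pv_nmul :: "('a, 'b) pvg_scheme \<Rightarrow> nat \<Rightarrow> 'a \<Rightarrow> 'a" where
  "pv_nmul G n x = ((pv_add G x) ^^ n) (pv_zero G)"

definition abelian_group_on :: "('a, 'b) pvg_scheme \<Rightarrow> bool" where
  "abelian_group_on G \<longleftrightarrow>
     pv_zero G \<in> pv_carrier G \<and>
     (\<forall>x\<in>pv_carrier G. \<forall>y\<in>pv_carrier G. pv_add G x y \<in> pv_carrier G) \<and>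
     (\<forall>x\<in>pv_carrier G. pv_neg G x \<in> pv_carrier G) \<and>
     (\<forall>x\<in>pv_carrier G. \<forall>y\<in>pv_carrier G. \<forall>z\<in>pv_carrier G.
        pv_add G (pv_add G x y) z = pv_add G x (pv_add G y z)) \<and>
     (\<forall>x\<in>pv_carrier G. \<forall>y\<in>pv_carrier G. pv_add G x y = pv_add G y x) \<and>
     (\<forall>x\<in>pv_carrier G. pv_add G x (pv_zero G) = x) \<and>
     (\<forall>x\<in>pv_carrier G. pv_add G x (pv_neg G x) = pv_zero G)"

definition pseudovector_group :: "('a, 'b) pvg_scheme \<Rightarrow> bool" where
  "pseudovector_group G \<longleftrightarrow>
     abelian_group_on G \<and>
     (\<forall>t\<ge>0. \<forall>x\<in>pv_carrier G. pv_act G t x \<in> pv_carrier G) \<and>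
     (\<forall>x\<in>pv_carrier G. pv_act G 0 x = pv_zero G) \<and>
     (\<forall>x\<in>pv_carrier G. pv_act G 1 x = x) \<and>
     (\<forall>s\<ge>0. \<forall>t\<ge>0. \<forall>x\<in>pv_carrier G. pv_act G (s * t) x = pv_act G s (pv_act G t x)) \<and>
     (\<forall>t\<ge>0. \<forall>x\<in>pv_carrier G. \<forall>y\<in>pv_carrier G.
        pv_act G t (pv_add G x y) = pv_add G (pv_act G t x) (pv_act G t y))"

definition is_value :: "('a, 'b) pvg_scheme \<Rightarrow> bool" where
  "is_value G \<longleftrightarrow>
     (\<forall>x\<in>pv_carrier G. pv_norm G x \<ge> 0) \<and>
     (\<forall>x\<in>pv_carrier G. pv_norm G x = 0 \<longleftrightarrow> x = pv_zero G) \<and>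
     (\<forall>x\<in>pv_carrier G. pv_norm G (pv_neg G x) = pv_norm G x) \<and>
     (\<forall>x\<in>pv_carrier G. \<forall>y\<in>pv_carrier G.
        pv_norm G (pv_add G x y) \<le> pv_norm G x + pv_norm G y)"

definition valued_abelian_group :: "('a, 'b) pvg_scheme \<Rightarrow> bool" where
  "valued_abelian_group G \<longleftrightarrow> abelian_group_on G \<and> is_value G"

definition subnormed_pvg :: "('a, 'b) pvg_scheme \<Rightarrow> bool" where
  "subnormed_pvg G \<longleftrightarrow> pseudovector_group G \<and> is_value G \<and>
     (\<forall>t\<ge>0. \<forall>x\<in>pv_carrier G. pv_norm G (pv_act G t x) \<le> max t 1 * pv_norm G x)"

definition subnormed_top_pvg :: "('a, 'b) pvg_scheme \<Rightarrow> bool" where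
  "subnormed_top_pvg G \<longleftrightarrow> subnormed_pvg G \<and>
     (\<forall>t\<ge>0. \<forall>x\<in>pv_carrier G. \<forall>\<epsilon>>0. \<exists>\<delta>>0. \<forall>s\<ge>0. \<forall>y\<in>pv_carrier G.
        \<bar>s - t\<bar> < \<delta> \<and> pv_dist G y x < \<delta> \<longrightarrow>
        pv_dist G (pv_act G s y) (pv_act G t x) < \<epsilon>)"

definition class_O00 :: "('a, 'b) pvg_scheme \<Rightarrow> bool" where
  "class_O00 G \<longleftrightarrow> (\<forall>g\<in>pv_carrier G.
     ((\<lambda>t. pv_norm G (pv_act G t g) / t) \<longlongrightarrow> 0) at_top \<and>
     ((\<lambda>n. pv_norm G (pv_nmul G n g) / real n) \<longlongrightarrow> 0) sequentially)"

definition class_O0 :: "('a, 'b) pvg_scheme \<Rightarrow> bool" where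
  "class_O0 G \<longleftrightarrow> (\<forall>a\<in>pv_carrier G.
     ((\<lambda>n. pv_norm G (pv_nmul G n a) / real n) \<longlongrightarrow> 0) sequentially)"

definition pv_lin :: "('a, 'b) pvg_scheme \<Rightarrow> 'a set \<Rightarrow> 'a set" where
  "pv_lin G A = {foldr (pv_add G) (map (\<lambda>(t, a). pv_act G t a) xs) (pv_zero G) | xs.
      xs \<noteq> [] \<and> (\<forall>(t, a)\<in>set xs. t \<ge> 0 \<and> a \<in> A \<union> pv_neg G ` A \<union> {pv_zero G})}"

definition pv_lipschitz_elem :: "('a, 'b) pvg_scheme \<Rightarrow> 'a \<Rightarrow> bool" where
  "pv_lipschitz_elem G a \<longleftrightarrow> (\<exists>L. \<forall>s\<ge>0. \<forall>t\<ge>0.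
     pv_dist G (pv_act G s a) (pv_act G t a) \<le> L * \<bar>s - t\<bar>)"

definition pv_bounded_elem :: "('a, 'b) pvg_scheme \<Rightarrow> 'a \<Rightarrow> bool" where
  "pv_bounded_elem G a \<longleftrightarrow> (\<exists>M. \<forall>x\<in>pv_lin G {a}. \<forall>y\<in>pv_lin G {a}. pv_dist G x y \<le> M)"

definition pv_finite_order :: "('a, 'b) pvg_scheme \<Rightarrow> 'a \<Rightarrow> bool" where
  "pv_finite_order G a \<longleftrightarrow> (\<exists>n\<ge>1. pv_nmul G n a = pv_zero G)"

definition pv_E :: "('a, 'b) pvg_scheme \<Rightarrow> 'a set" where
  "pv_E G = {a \<in> pv_carrier G. pv_finite_order G a \<and> pv_lipschitz_elem G a \<and> pv_bounded_elem G a}"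

definition pv_dense_in :: "('a, 'b) pvg_scheme \<Rightarrow> 'a set \<Rightarrow> bool" where
  "pv_dense_in G D \<longleftrightarrow> D \<subseteq> pv_carrier G \<and>
     (\<forall>x\<in>pv_carrier G. \<forall>\<epsilon>>0. \<exists>d\<in>D. pv_dist G x d < \<epsilon>)"

definition pv_enlarging ::
  "('a, 'b) pvg_scheme \<Rightarrow> ('c, 'd) pvg_scheme \<Rightarrow> ('a \<Rightarrow> 'c) \<Rightarrow> bool" where
  "pv_enlarging G H f \<longleftrightarrow>
     f ` pv_carrier G \<subseteq> pv_carrier H \<and> inj_on f (pv_carrier G) \<and>
     (\<forall>x\<in>pv_carrier G. \<forall>y\<in>pv_carrier G. f (pv_add G x y) = pv_add H (f x) (f y)) \<and>
     (\<forall>t\<ge>0. \<forall>x\<in>pv_carrier G. f (pv_act G t x) = pv_act H t (f x)) \<and>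
     (\<forall>x\<in>pv_carrier G. pv_norm H (f x) = pv_norm G x)"

definition pv_separable :: "('a, 'b) pvg_scheme \<Rightarrow> bool" where
  "pv_separable G \<longleftrightarrow> (\<exists>D. countable D \<and> pv_dense_in G D)"

definition frakG :: "ereal \<Rightarrow> nat \<Rightarrow> ('a, 'b) pvg_scheme \<Rightarrow> bool" where
  "frakG r N G \<longleftrightarrow> valued_abelian_group G \<and> pv_separable G \<and> class_O0 G \<and>
     (\<forall>x\<in>pv_carrier G. ereal (pv_norm G x) \<le> r) \<and>
     (N \<noteq> 0 \<longrightarrow> (\<forall>x\<in>pv_carrier G. pv_nmul G N x = pv_zero G))"

end

theory Submission
  imports Defs "HOL-Algebra.Free_Abelian_Groups" "HOL-Analysis.Analysis"
begin

text \<open>Elements with bounded orbits grow at rate 0, and this passes to limits; that gives the easy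
  direction. Conversely, for every \<open>a\<close> in a dense subset of \<open>G\<close> and every small \<open>\<epsilon>\<close>, adjoin the
  pseudovector group of combinations \<open>\<Sum> V t [t]\<close> over \<open>\<int>/n\<close> of a generator \<open>b\<close>, where
  \<open>[t]\<close> stands for \<open>t * b\<close>. Viewed as the step function \<open>x \<mapsto> \<Sum>t\<ge>x. V t\<close>, such a
  combination gets the norm \<open>min M (L * \<mu>)\<close>, where \<open>\<mu>\<close> is the measure of the support; so \<open>b\<close> has
  order \<open>n\<close> and is Lipschitz and bounded. On the sum of \<open>G\<close> and all these groups take the
  largest subnorm that puts \<open>b\<close> within \<open>\<epsilon>\<close> of \<open>a\<close>. It extends the norm of \<open>G\<close> because
  \<open>\<parallel>\<Sum> V t (t * a)\<parallel> \<le> \<epsilon> \<Sum> \<bar>V t\<bar> max t 1 + min M (L * \<mu>)\<close> for suitable \<open>n\<close>, \<open>M\<close>, \<open>L\<close>: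
  if \<open>\<mu>\<close> is small, every cell of a fine grid contains a point off the support, and moving each
  \<open>t\<close> down to the nearest such point makes all coefficients divisible by \<open>n\<close>. The case
  \<open>r = 1\<close> truncates the norm at 1.\<close>

section \<open>Pseudonorms on Abelian groups\<close>

text \<open>Putting \<open>b\<close> within \<epsilon> of \<open>a\<close> forces
  \<open>t * b\<close> to lie within \<epsilon> max(t, 1) of \<open>t * a\<close>, since the action
  may stretch a subnorm by max(t, 1). Relations and short differences among the \<open>t * b\<close>
  then pull the corresponding combinations of the \<open>t * a\<close> towards 0, and the norm of
  \<open>G\<close> survives only if these were already that small. Both limits in
  \<open>class_O00\<close> enter here. Slow growth of \<open>t * a\<close> lets large
  \<open>t\<close> be moved to 0. Slow growth of multiples bounds arbitrary coefficients at finitely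
  many grid points by a constant plus a small slope, which is the origin of \<open>M\<close>. It
  also supplies the order n, chosen so that all multiples of n are slow; under exponent N, n = N
  works because these multiples vanish. \<open>L\<close> is \<open>M\<close> divided by the mesh of
  the grid. Up to the last stage the algebra takes place in free Abelian groups with pseudonorms,
  where most laws hold up to null elements only. These are divided out once, and the classes are
  coded in \<open>'a \<times> real\<close>.\<close>

locale pseudonorm =
  fixes Q :: "'k::ab_group_add \<Rightarrow> real"
  assumes zero [simp]: "Q 0 = 0"
    and minus [simp]: "Q (- x) = Q x"
    and triangle: "Q (x + y) \<le> Q x + Q y"
begin

lemma nonneg [simp]: "0 \<le> Q x"
  using triangle [of x "- x"] by simp

lemma diff_le: "Q (x - y) \<le> Q x + Q y"
  using triangle [of x "- y"] by simp

lemma commute: "Q (x - y) = Q (y - x)"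
  using minus [of "x - y"] by simp

lemma dist_triangle: "Q (x - z) \<le> Q (x - y) + Q (y - z)"
  using triangle [of "x - y" "y - z"] by simp

lemma le_add_diff: "Q x \<le> Q y + Q (x - y)"
  using triangle [of y "x - y"] by simp

lemma eq_of_diff_zero: "Q (x - y) = 0 \<Longrightarrow> Q x = Q y"
  using le_add_diff [of x y] le_add_diff [of y x] commute [of x y] by simp

lemma sum_le: "Q (sum f I) \<le> (\<Sum>i\<in>I. Q (f i))"
proof (induction I rule: infinite_finite_induct)
  case (insert i I)
  then show ?case using triangle [of "f i" "sum f I"] by simp
qed auto

end

lemma pseudonorm_min:
  assumes "pseudonorm Q" "0 \<le> (c::real)"
  shows "pseudonorm (\<lambda>x. min (Q x) c)"
proof -
  interpret pseudonorm Q by fact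
  show ?thesis
  proof
    show "min (Q (x + y)) c \<le> min (Q x) c + min (Q y) c" for x y
      using triangle [of x y] nonneg [of x] nonneg [of y] \<open>0 \<le> c\<close> by linarith
  qed (use \<open>0 \<le> c\<close> in auto)
qed

locale frag_pseudonorm = pseudonorm Q for Q :: "('x \<Rightarrow>\<^sub>0 int) \<Rightarrow> real"
begin

lemma frag_cmul_le: "Q (frag_cmul c x) \<le> \<bar>real_of_int c\<bar> * Q x"
proof -
  have nat: "Q (frag_cmul (int n) x) \<le> real n * Q x" for n
  proof (induction n)
    case (Suc n)
    have "Q (frag_cmul (int (Suc n)) x) \<le> Q x + Q (frag_cmul (int n) x)"
      using triangle [of x "frag_cmul (int n) x"] by (simp add: frag_cmul_distrib)
    with Suc show ?case by (simp add: algebra_simps)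
  qed simp
  show ?thesis
  proof (cases "0 \<le> c")
    case True
    then show ?thesis using nat [of "nat c"] by simp
  next
    case False
    then show ?thesis
      using nat [of "nat (- c)"] minus [of "frag_cmul (- c) x"] by simp
  qed
qed

lemma frag_extend_le:
  "Q (frag_extend f V) \<le> (\<Sum>k\<in>Poly_Mapping.keys V. \<bar>real_of_int (Poly_Mapping.lookup V k)\<bar> * Q (f k))"
  unfolding frag_extend_def
  by (rule order_trans [OF sum_le sum_mono]) (rule frag_cmul_le)

text \<open>Only finitely many multiples violate the slope \<open>\<eta>\<close>; they are absorbed
  into the constant \<open>n0 * Q x\<close>.\<close>

lemma finite_bound:
  assumes "(\<lambda>n. Q (frag_cmul (int n) x) / real n) \<longlonglongrightarrow> 0" "0 < \<eta>"
  obtains C where "0 \<le> C" "\<And>c. Q (frag_cmul c x) \<le> C + \<eta> * \<bar>real_of_int c\<bar>"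
proof -
  have "\<forall>\<^sub>F n in sequentially. Q (frag_cmul (int n) x) / real n < \<eta>"
    using assms by (rule order_tendstoD)
  then obtain n0 where n0: "\<And>n. n \<ge> n0 \<Longrightarrow> Q (frag_cmul (int n) x) / real n < \<eta>"
    by (auto simp: eventually_sequentially)
  have nat: "Q (frag_cmul (int n) x) \<le> real n0 * Q x + \<eta> * real n" for n
  proof (cases "n0 \<le> n \<and> 0 < n")
    case True
    then have "Q (frag_cmul (int n) x) \<le> \<eta> * real n"
      using n0 [of n] by (simp add: divide_simps split: if_splits)
    then show ?thesis by (simp add: add_increasing)
  next
    case False
    then have "n \<le> n0" by auto
    then have "Q (frag_cmul (int n) x) \<le> real n0 * Q x"
      using frag_cmul_le [of "int n" x] mult_right_mono [of "real n" "real n0" "Q x"] by simp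
    then show ?thesis using \<open>0 < \<eta>\<close> by (simp add: add_increasing2)
  qed
  show ?thesis
  proof
    show "0 \<le> real n0 * Q x" by simp
    show "Q (frag_cmul c x) \<le> real n0 * Q x + \<eta> * \<bar>real_of_int c\<bar>" for c
    proof (cases "0 \<le> c")
      case True
      then show ?thesis using nat [of "nat c"] by simp
    next
      case False
      then show ?thesis
        using nat [of "nat (- c)"] minus [of "frag_cmul (- c) x"] by simp
    qed
  qed
qed

end

text \<open>The l1-norm on the free Abelian group with weight \<open>w k\<close> on the generator
  \<open>k\<close>.\<close>

definition frag_norm :: "('x \<Rightarrow> real) \<Rightarrow> ('x \<Rightarrow>\<^sub>0 int) \<Rightarrow> real" where
  "frag_norm w V = (\<Sum>k\<in>Poly_Mapping.keys V. \<bar>real_of_int (Poly_Mapping.lookup V k)\<bar> * w k)"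

lemma frag_norm_superset:
  assumes "finite K" "Poly_Mapping.keys V \<subseteq> K"
  shows "frag_norm w V = (\<Sum>k\<in>K. \<bar>real_of_int (Poly_Mapping.lookup V k)\<bar> * w k)"
  unfolding frag_norm_def
  by (rule sum.mono_neutral_left) (use assms in \<open>auto simp: in_keys_iff\<close>)

lemma frag_norm_of [simp]: "frag_norm w (frag_of k) = w k"
  by (simp add: frag_norm_def)

lemma frag_pseudonorm_frag_norm:
  assumes "\<And>k. 0 \<le> w k"
  shows "frag_pseudonorm (frag_norm w)"
proof (unfold_locales)
  show "frag_norm w (x + y) \<le> frag_norm w x + frag_norm w y" for x y
  proof -
    define K where "K = Poly_Mapping.keys x \<union> Poly_Mapping.keys y"
    have K: "finite K" "Poly_Mapping.keys x \<subseteq> K" "Poly_Mapping.keys y \<subseteq> K" "Poly_Mapping.keys (x + y) \<subseteq> K"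
      using keys_add [of x y] by (auto simp: K_def)
    have "\<bar>real_of_int (Poly_Mapping.lookup (x + y) k)\<bar> * w k
        \<le> \<bar>real_of_int (Poly_Mapping.lookup x k)\<bar> * w k + \<bar>real_of_int (Poly_Mapping.lookup y k)\<bar> * w k" for k
      unfolding distrib_right [symmetric]
      by (rule mult_right_mono) (use assms in \<open>auto simp: lookup_add\<close>)
    then show ?thesis
      unfolding frag_norm_superset [OF K(1,2)] frag_norm_superset [OF K(1,3)] frag_norm_superset [OF K(1,4)]
        sum.distrib [symmetric] by (rule sum_mono)
  qed
qed (auto simp: frag_norm_def)

lemma frag_norm_mult: "frag_norm (\<lambda>k. c * w k) V = c * frag_norm w V"
  by (simp add: frag_norm_def sum_distrib_left algebra_simps)

text \<open>By the triangle inequality an additive map is controlled by its values on generators;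
  rescaling and snapping are both instances.\<close>

lemma frag_norm_extend_le:
  assumes w: "\<And>k. 0 \<le> w k" and f: "\<And>k. k \<in> Poly_Mapping.keys V \<Longrightarrow> frag_norm w (f k) \<le> u k"
  shows "frag_norm w (frag_extend f V) \<le> frag_norm u V"
proof -
  interpret frag_pseudonorm "frag_norm w" by (rule frag_pseudonorm_frag_norm) (rule w)
  show ?thesis
    by (rule order_trans [OF frag_extend_le])
       (auto simp: frag_norm_def [of u] intro!: sum_mono mult_left_mono f)
qed

section \<open>Pseudovector structures with a pseudonorm\<close>

text \<open>Additivity of the action is exact, whereas the other laws hold up to null elements. The
  lift of an action to a free Abelian group has just this form, and exact additivity gives exact
  rules for 0 and differences.\<close>

locale pseudo_pvg = pseudonorm Q for Q :: "'k::ab_group_add \<Rightarrow> real" +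
  fixes \<sigma> :: "real \<Rightarrow> 'k \<Rightarrow> 'k"
  assumes act_add: "0 \<le> t \<Longrightarrow> \<sigma> t (x + y) = \<sigma> t x + \<sigma> t y"
    and act_null: "Q (\<sigma> 0 x) = 0"
    and act_one: "Q (\<sigma> 1 x - x) = 0"
    and act_mult: "\<lbrakk>0 \<le> s; 0 \<le> t\<rbrakk> \<Longrightarrow> Q (\<sigma> (s * t) x - \<sigma> s (\<sigma> t x)) = 0"
    and act_le: "0 \<le> t \<Longrightarrow> Q (\<sigma> t x) \<le> max t 1 * Q x"
begin

lemma act_0 [simp]: "0 \<le> t \<Longrightarrow> \<sigma> t 0 = 0"
  using act_add [of t 0 0] by simp

lemma act_minus: "0 \<le> t \<Longrightarrow> \<sigma> t (- x) = - \<sigma> t x"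
  using act_add [of t x "- x"] by (simp add: eq_neg_iff_add_eq_0 add.commute)

lemma act_diff: "0 \<le> t \<Longrightarrow> \<sigma> t (x - y) = \<sigma> t x - \<sigma> t y"
  using act_add [of t x "- y"] by (simp add: act_minus)

lemma act_dist_le: "0 \<le> t \<Longrightarrow> Q (\<sigma> t x - \<sigma> t y) \<le> max t 1 * Q (x - y)"
  using act_le [of t "x - y"] by (simp add: act_diff)

end

section \<open>The switching length of a combination of scalars\<close>

text \<open>The integer step function that sums \<open>V t\<close> over \<open>t \<ge> x\<close>.
  Reading it off as the coefficient of the single generator \<open>()\<close> of a free group lets
  linearity come from \<open>frag_extend\<close>.\<close>

definition cum :: "(real \<Rightarrow>\<^sub>0 int) \<Rightarrow> real \<Rightarrow> int" where
  "cum V x = Poly_Mapping.lookup (frag_extend (\<lambda>t. if x \<le> t then frag_of () else 0) V) ()"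

lemma cum_0 [simp]: "cum 0 x = 0"
  by (simp add: cum_def)

lemma cum_add [simp]: "cum (V + W) x = cum V x + cum W x"
  by (simp add: cum_def frag_extend_add lookup_add)

lemma cum_diff [simp]: "cum (V - W) x = cum V x - cum W x"
  by (simp add: cum_def frag_extend_diff lookup_minus)

lemma cum_minus [simp]: "cum (- V) x = - cum V x"
  by (simp add: cum_def frag_extend_minus)

lemma cum_cmul [simp]: "cum (frag_cmul c V) x = c * cum V x"
  by (simp add: cum_def frag_extend_cmul)

lemma cum_of [simp]: "cum (frag_of t) x = (if x \<le> t then 1 else 0)"
  by (simp add: cum_def)

lemma cum_one [simp]: "cum 1 x = (if x \<le> 0 then 1 else 0)"
  using cum_of [of 0 x] by simp

lemma borel_measurable_cum: "(\<lambda>x. real_of_int (cum V x)) \<in> borel_measurable borel"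
  using subset_UNIV by (induction V rule: frag_induction) (auto intro!: borel_measurable_diff)

lemma cum_eventually_0: "\<exists>b. \<forall>x>b. cum V x = 0"
  using subset_UNIV
proof (induction V rule: frag_induction)
  case (diff a b)
  then obtain u v where "\<forall>x>u. cum a x = 0" "\<forall>x>v. cum b x = 0" by blast
  then have "\<forall>x>max u v. cum (a - b) x = 0" by simp
  then show ?case by blast
next
  case (one t)
  have "\<forall>x>t. cum (frag_of t) x = 0" by simp
  then show ?case by blast
qed simp

text \<open>The support of the step function modulo \<open>n\<close>. Only positive \<open>x\<close>
  count, so that \<open>frag_of 0\<close>, which stands for \<open>0 * b = 0\<close>, has empty
  support.\<close>

definition switch_set :: "nat \<Rightarrow> (real \<Rightarrow>\<^sub>0 int) \<Rightarrow> real set" where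
  "switch_set n V = {x. 0 < x \<and> \<not> int n dvd cum V x}"

definition switch_len :: "nat \<Rightarrow> (real \<Rightarrow>\<^sub>0 int) \<Rightarrow> real" where
  "switch_len n V = measure lebesgue (switch_set n V)"

lemma switch_set_lmeasurable: "switch_set n V \<in> lmeasurable"
proof -
  have "countable (real_of_int ` {z. \<not> int n dvd z})" by simp
  then have "real_of_int ` {z. \<not> int n dvd z} \<in> sets borel" by (rule sets.countable [rotated]) simp
  then have "(\<lambda>x. real_of_int (cum V x)) -` (real_of_int ` {z. \<not> int n dvd z}) \<inter> space borel \<in> sets borel"
    by (rule measurable_sets [OF borel_measurable_cum])
  then have "{0<..} \<inter> (\<lambda>x. real_of_int (cum V x)) -` (real_of_int ` {z. \<not> int n dvd z}) \<in> sets borel"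
    by (intro sets.Int) auto
  also have "{0<..} \<inter> (\<lambda>x. real_of_int (cum V x)) -` (real_of_int ` {z. \<not> int n dvd z}) = switch_set n V"
    by (auto simp: switch_set_def)
  finally have meas: "switch_set n V \<in> sets lebesgue" by simp
  obtain b where "\<forall>x>b. cum V x = 0" using cum_eventually_0 by blast
  then have "x \<le> b" if "x \<in> switch_set n V" for x
    using that \<open>\<forall>x>b. cum V x = 0\<close> by (metis (mono_tags) dvd_0_right mem_Collect_eq not_le switch_set_def)
  then have "switch_set n V \<subseteq> {0..b}" by (auto simp: switch_set_def)
  then have "bounded (switch_set n V)" by (rule bounded_subset [OF bounded_closed_interval])
  then show ?thesis using meas bounded_set_imp_lmeasurable by blast
qed

lemma switch_len_nonneg [simp]: "0 \<le> switch_len n V"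
  by (simp add: switch_len_def)

lemma switch_len_mono: "switch_set n V \<subseteq> S \<Longrightarrow> S \<in> lmeasurable \<Longrightarrow> switch_len n V \<le> measure lebesgue S"
  unfolding switch_len_def by (rule measure_mono_fmeasurable) (auto simp: switch_set_lmeasurable fmeasurableD)

lemma pseudonorm_switch_len: "pseudonorm (switch_len n)"
proof
  show "switch_len n 0 = 0" "switch_len n (- V) = switch_len n V" for V
    by (simp_all add: switch_len_def switch_set_def)
  show "switch_len n (V + W) \<le> switch_len n V + switch_len n W" for V W
  proof -
    have "switch_len n (V + W) \<le> measure lebesgue (switch_set n V \<union> switch_set n W)"
      by (rule switch_len_mono)
         (auto simp: switch_set_lmeasurable intro!: fmeasurable.Un, auto simp: switch_set_def)
    also have "\<dots> \<le> switch_len n V + switch_len n W"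
      unfolding switch_len_def
      by (rule measure_Un_le) (auto simp: switch_set_lmeasurable fmeasurableD)
    finally show ?thesis .
  qed
qed

lemma switch_len_cmul: "int n dvd c \<Longrightarrow> switch_len n (frag_cmul c V) = 0"
  by (simp add: switch_len_def switch_set_def)

text \<open>Up to sign, the step function of the difference is the indicator of the interval between
  \<open>s\<close> and \<open>t\<close>. This makes the generator Lipschitz.\<close>

lemma switch_len_step_le: "switch_len n (frag_of s - frag_of t) \<le> \<bar>s - t\<bar>"
proof -
  have "switch_len n (frag_of s - frag_of t) \<le> measure lebesgue {min s t..max s t}"
    by (rule switch_len_mono) (auto simp: switch_set_def split: if_splits)
  also have "\<dots> = \<bar>s - t\<bar>" by (simp add: max_def min_def)
  finally show ?thesis .
qed

definition dilate :: "real \<Rightarrow> (real \<Rightarrow>\<^sub>0 int) \<Rightarrow> (real \<Rightarrow>\<^sub>0 int)" where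
  "dilate s V = frag_extend (\<lambda>t. frag_of (s * t)) V"

lemma cum_dilate: "0 < s \<Longrightarrow> cum (dilate s V) x = cum V (x / s)"
  unfolding dilate_def using subset_UNIV
  by (induction V rule: frag_induction) (auto simp: frag_extend_diff field_simps)

lemma cum_dilate_0: "0 < x \<Longrightarrow> cum (dilate 0 V) x = 0"
  unfolding dilate_def using subset_UNIV
  by (induction V rule: frag_induction) (auto simp: frag_extend_diff)

text \<open>For \<open>s > 0\<close> the step function is stretched by \<open>s\<close>, and
  Lebesgue measure scales accordingly; for \<open>s = 0\<close> all scalars collapse to 0, where
  nothing is measured.\<close>

lemma switch_len_dilate:
  assumes "0 \<le> s"
  shows "switch_len n (dilate s V) = s * switch_len n V"
proof (cases "s = 0")
  case True
  then have "switch_set n (dilate s V) = {}" by (auto simp: switch_set_def cum_dilate_0)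
  then show ?thesis using True by (simp add: switch_len_def)
next
  case False
  with assms have "0 < s" by simp
  then have "x \<in> switch_set n (dilate s V) \<longleftrightarrow> x / s \<in> switch_set n V" for x
    by (simp add: switch_set_def cum_dilate zero_less_divide_iff)
  then have "switch_set n (dilate s V) = (\<lambda>x. x / s) -` switch_set n V" by auto
  moreover have "(\<lambda>x. x / s) -` switch_set n V = (\<lambda>x. s *\<^sub>R x + 0) ` switch_set n V"
  proof (rule equalityI; rule subsetI)
    fix x assume "x \<in> (\<lambda>x. x / s) -` switch_set n V"
    then show "x \<in> (\<lambda>x. s *\<^sub>R x + 0) ` switch_set n V"
      using \<open>0 < s\<close> by (intro image_eqI [of _ _ "x / s"]) auto
  qed (use \<open>0 < s\<close> in auto)
  ultimately have "switch_set n (dilate s V) = (\<lambda>x. s *\<^sub>R x + 0) ` switch_set n V" by simp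
  then have "switch_len n (dilate s V) = \<bar>s\<bar> ^ DIM(real) * switch_len n V"
    unfolding switch_len_def by (simp only: measure_lebesgue_affine)
  then show ?thesis using \<open>0 < s\<close> by simp
qed

section \<open>Snapping to a grid\<close>

text \<open>Rounds down to the nearest of \<open>x 0\<close>, ..., \<open>x (K - 1)\<close>. Values
  below \<open>x 0\<close> go to 0, and so do values from \<open>x K\<close> on: for such large
  \<open>t\<close> the vector \<open>t * a\<close> is itself small compared with
  \<open>t\<close>.\<close>

definition snap :: "(nat \<Rightarrow> real) \<Rightarrow> nat \<Rightarrow> real \<Rightarrow> real" where
  "snap x K t = (if \<exists>k<K. x k \<le> t \<and> t < x (Suc k)
                 then x (SOME k. k < K \<and> x k \<le> t \<and> t < x (Suc k)) else 0)"

lemma snap_eq: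
  assumes "strict_mono x" "k < K" "x k \<le> t" "t < x (Suc k)"
  shows "snap x K t = x k"
proof -
  have uniq: "j = k" if "x j \<le> t" "t < x (Suc j)" for j
  proof -
    have "x j < x (Suc k)" "x k < x (Suc j)" using that assms by linarith+
    then have "j < Suc k" "k < Suc j" by (simp_all only: strict_mono_less [OF assms(1)])
    then show ?thesis by simp
  qed
  have ex: "k < K \<and> x k \<le> t \<and> t < x (Suc k)" using assms by simp
  then have "(SOME k. k < K \<and> x k \<le> t \<and> t < x (Suc k)) = k"
    by (rule some_equality) (rule uniq, simp_all)
  moreover have "\<exists>k<K. x k \<le> t \<and> t < x (Suc k)" using ex by blast
  ultimately show ?thesis by (simp only: snap_def if_True)
qed

lemma snap_cases:
  assumes "strict_mono x"
  obtains (cell) k where "k < K" "x k \<le> t" "t < x (Suc k)" "snap x K t = x k"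
  | (low) "t < x 0" "snap x K t = 0"
  | (high) "x K \<le> t" "snap x K t = 0"
proof (cases "\<exists>k<K. x k \<le> t \<and> t < x (Suc k)")
  case True
  then show ?thesis using snap_eq [OF assms] cell by blast
next
  case False
  then have eq: "snap x K t = 0" by (auto simp: snap_def)
  have "x k \<le> t" if "x 0 \<le> t" "k \<le> K" for k
    using that(2)
  proof (induction k)
    case (Suc k)
    then have "x k \<le> t" "k < K" by simp_all
    then show ?case using False not_less by blast
  qed (rule that(1))
  then show ?thesis using eq low high by (cases "t < x 0") auto
qed

text \<open>Exactly the scalars from \<open>x k\<close> up to, but excluding,
  \<open>x (Suc k)\<close> are rounded to \<open>x k\<close>. Hence divisibility of
  \<open>cum\<close> at grid points passes to the coefficients. Positivity of \<open>x 0\<close>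
  keeps the default value 0 apart from the grid points.\<close>

lemma lookup_snap:
  assumes mono: "strict_mono x" and pos: "0 < x 0" and "k < K"
  shows "Poly_Mapping.lookup (frag_extend (\<lambda>t. frag_of (snap x K t)) V) (x k) = cum V (x k) - cum V (x (Suc k))"
  using subset_UNIV
proof (induction V rule: frag_induction)
  case (one t)
  have x_pos: "0 < x j" for j using strict_mono_less_eq [OF mono, of 0 j] pos by simp
  have suc: "x k < x (Suc k)" using mono by (simp add: strict_mono_Suc_iff)
  have iff: "snap x K t = x k \<longleftrightarrow> x k \<le> t \<and> t < x (Suc k)"
  proof
    assume eq: "snap x K t = x k"
    from mono show "x k \<le> t \<and> t < x (Suc k)"
    proof (cases rule: snap_cases [where K = K and t = t])
      case (cell j)
      then have "x j = x k" using eq by (simp only:)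
      then have "j = k" by (simp only: strict_mono_eq [OF mono])
      then show ?thesis using cell(2,3) by (simp only: conj_absorb simp_thms)
    qed (use x_pos [of k] eq in simp_all)
  qed (use snap_eq [OF mono \<open>k < K\<close>] in auto)
  have "(if x k = snap x K t then 1 else 0)
      = (if x k \<le> t then 1 else 0) - (if x (Suc k) \<le> t then 1 else (0::int))"
    unfolding eq_commute [of "x k" "snap x K t"] iff using suc by simp
  then show ?case unfolding frag_extend_of lookup_frag_of cum_of .
qed (auto simp: frag_extend_diff lookup_minus)

section \<open>Combinations of the vectors \<open>t * a\<close> along one orbit\<close>

locale frag_pvg = pseudo_pvg P \<sigma> for P :: "('x \<Rightarrow>\<^sub>0 int) \<Rightarrow> real" and \<sigma>
begin

sublocale frag_pseudonorm P ..

lemma act_frag_cmul: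
  assumes "0 \<le> t"
  shows "\<sigma> t (frag_cmul c x) = frag_cmul c (\<sigma> t x)"
proof -
  have nat: "\<sigma> t (frag_cmul (int n) x) = frag_cmul (int n) (\<sigma> t x)" for n
    by (induction n) (simp_all add: frag_cmul_distrib act_add assms)
  show ?thesis
  proof (cases "0 \<le> c")
    case True
    then show ?thesis using nat [of "nat c"] by simp
  next
    case False
    then show ?thesis
      using nat [of "nat (- c)"] act_minus [OF assms, of "frag_cmul (- c) x"] by simp
  qed
qed

text \<open>The truncation \<^term>\<open>max 0 t\<close> only totalises the map: the action is meaningless for negative scalars.\<close>

definition orbit :: "('x \<Rightarrow>\<^sub>0 int) \<Rightarrow> (real \<Rightarrow>\<^sub>0 int) \<Rightarrow> ('x \<Rightarrow>\<^sub>0 int)" where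
  "orbit a V = frag_extend (\<lambda>t. \<sigma> (max 0 t) a) V"

text \<open>A Lebesgue number for the cover of \<open>{0..T}\<close> by balls of continuity. Only
  \<open>s\<close> is confined to the interval; \<open>t\<close> may exceed \<open>T\<close>, as
  continuity at a centre concerns all nonnegative scalars.\<close>

lemma orbit_uniformly_continuous:
  assumes cont: "\<And>t e. \<lbrakk>0 \<le> t; 0 < e\<rbrakk> \<Longrightarrow> \<exists>d>0. \<forall>s\<ge>0. \<bar>s - t\<bar> < d \<longrightarrow> P (\<sigma> s a - \<sigma> t a) < e"
    and "0 < \<eta>"
  obtains d where "0 < d"
    "\<And>s t. \<lbrakk>0 \<le> s; s \<le> T; 0 \<le> t; \<bar>t - s\<bar> < d\<rbrakk> \<Longrightarrow> P (\<sigma> t a - \<sigma> s a) < \<eta>"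
proof -
  have "\<forall>t\<in>{0..T}. \<exists>d>0. \<forall>s\<ge>0. \<bar>s - t\<bar> < d \<longrightarrow> P (\<sigma> s a - \<sigma> t a) < \<eta> / 2"
  proof
    fix t assume "t \<in> {0..T}"
    then show "\<exists>d>0. \<forall>s\<ge>0. \<bar>s - t\<bar> < d \<longrightarrow> P (\<sigma> s a - \<sigma> t a) < \<eta> / 2"
      using \<open>0 < \<eta>\<close> by (intro cont) auto
  qed
  then obtain \<delta> where \<delta>: "\<And>t. t \<in> {0..T} \<Longrightarrow> 0 < \<delta> t"
    "\<And>s t. \<lbrakk>t \<in> {0..T}; 0 \<le> s; \<bar>s - t\<bar> < \<delta> t\<rbrakk> \<Longrightarrow> P (\<sigma> s a - \<sigma> t a) < \<eta> / 2"
    by metis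
  obtain e where "0 < e" and e: "\<forall>x\<in>{0..T}. \<exists>B\<in>(\<lambda>t. ball t (\<delta> t)) ` {0..T}. ball x e \<subseteq> B"
  proof (rule Heine_Borel_lemma)
    show "{0..T} \<subseteq> \<Union> ((\<lambda>t. ball t (\<delta> t)) ` {0..T})"
      using \<delta>(1) by (intro subsetI UN_I) auto
  qed auto
  show ?thesis
  proof
    show "P (\<sigma> t a - \<sigma> s a) < \<eta>" if st: "0 \<le> s" "s \<le> T" "0 \<le> t" "\<bar>t - s\<bar> < e" for s t
    proof -
      from st have "s \<in> {0..T}" by simp
      with e obtain u where u: "u \<in> {0..T}" "ball s e \<subseteq> ball u (\<delta> u)" by (metis imageE)
      have "s \<in> ball s e" "t \<in> ball s e" using st \<open>0 < e\<close> by (auto simp: dist_real_def)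
      then have "s \<in> ball u (\<delta> u)" "t \<in> ball u (\<delta> u)" using u(2) by blast+
      then have "\<bar>s - u\<bar> < \<delta> u" "\<bar>t - u\<bar> < \<delta> u" by (auto simp: dist_real_def)
      then have "P (\<sigma> s a - \<sigma> u a) < \<eta> / 2" "P (\<sigma> t a - \<sigma> u a) < \<eta> / 2"
        using \<delta>(2) u(1) st by auto
      then show ?thesis
        using dist_triangle [of "\<sigma> t a" "\<sigma> s a" "\<sigma> u a"] commute [of "\<sigma> u a" "\<sigma> s a"] by linarith
    qed
  qed (rule \<open>0 < e\<close>)
qed

text \<open>Each unit of coefficient at \<open>t\<close> pays at most
  \<open>\<eta> * max t 1\<close> for being moved. The rest is grouped by grid point with the whole
  coefficient kept inside \<open>P\<close>, so that its divisibility can be used later.\<close>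

lemma orbit_snap_le:
  assumes err: "\<And>t. P (\<sigma> (max 0 t) a - \<sigma> (max 0 (r t)) a) \<le> \<eta> * max t 1"
  defines "R \<equiv> \<lambda>V. frag_extend (\<lambda>t. frag_of (r t)) V"
  shows "P (orbit a V) \<le> \<eta> * frag_norm (\<lambda>t. max t 1) V
     + (\<Sum>y\<in>Poly_Mapping.keys (R V). P (frag_cmul (Poly_Mapping.lookup (R V) y) (\<sigma> (max 0 y) a)))"
proof -
  have "orbit a V - orbit a (R V) = frag_extend (\<lambda>t. \<sigma> (max 0 t) a - \<sigma> (max 0 (r t)) a) V"
    unfolding orbit_def R_def using subset_UNIV
    by (induction V rule: frag_induction) (auto simp: frag_extend_diff algebra_simps)
  then have "P (orbit a V - orbit a (R V))
      \<le> (\<Sum>k\<in>Poly_Mapping.keys V. \<bar>real_of_int (Poly_Mapping.lookup V k)\<bar> * (\<eta> * max k 1))"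
    by (simp only:) (rule order_trans [OF frag_extend_le], intro sum_mono mult_left_mono err, simp)
  also have "\<dots> = \<eta> * frag_norm (\<lambda>t. max t 1) V"
    by (simp add: frag_norm_def sum_distrib_left algebra_simps)
  finally have "P (orbit a V - orbit a (R V)) \<le> \<eta> * frag_norm (\<lambda>t. max t 1) V" .
  moreover have "P (orbit a (R V))
      \<le> (\<Sum>y\<in>Poly_Mapping.keys (R V). P (frag_cmul (Poly_Mapping.lookup (R V) y) (\<sigma> (max 0 y) a)))"
    unfolding orbit_def frag_extend_def [of _ "R V"] by (rule sum_le)
  ultimately show ?thesis using le_add_diff [of "orbit a V" "orbit a (R V)"] by linarith
qed

text \<open>Two regimes, separated by the mesh \<open>\<delta>\<close>. If
  \<open>switch_len n V\<close> is below it, a grid fitted to \<open>V\<close> avoids the support,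
  and \<open>tors\<close> handles each grid point. Otherwise a fixed grid gives the additive
  constant \<open>M\<close>, which \<open>L * switch_len n V\<close> dominates.\<close>

theorem orbit_bound:
  assumes cont: "\<And>t e. \<lbrakk>0 \<le> t; 0 < e\<rbrakk> \<Longrightarrow> \<exists>d>0. \<forall>s\<ge>0. \<bar>s - t\<bar> < d \<longrightarrow> P (\<sigma> s a - \<sigma> t a) < e"
    and slow: "((\<lambda>t. P (\<sigma> t a) / t) \<longlongrightarrow> 0) at_top"
    and slow_nat: "\<And>x. (\<lambda>n. P (frag_cmul (int n) x) / real n) \<longlonglongrightarrow> 0"
    and "0 < \<epsilon>"
    and tors: "\<And>k. P (frag_cmul (int n * k) a) \<le> \<epsilon> / 2 * \<bar>real_of_int (int n * k)\<bar>"
  obtains M L where "0 \<le> M" "0 \<le> L"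
    "\<And>V. P (orbit a V) \<le> \<epsilon> * frag_norm (\<lambda>t. max t 1) V + min M (L * switch_len n V)"
proof -
  \<comment> \<open>One half of \<open>\<epsilon>\<close> pays for the rounding, the other for the
    values at grid points.\<close>
  define \<eta> where "\<eta> = \<epsilon> / 2"
  have "0 < \<eta>" using \<open>0 < \<epsilon>\<close> by (simp add: \<eta>_def)
  define N where "N = frag_norm (\<lambda>t::real. max t 1)"
  interpret N: frag_pseudonorm N
    unfolding N_def by (rule frag_pseudonorm_frag_norm) simp
  have "\<forall>\<^sub>F t in at_top. P (\<sigma> t a) / t < \<eta>" using slow \<open>0 < \<eta>\<close> by (rule order_tendstoD)
  then obtain T0 where T0: "\<And>t. t \<ge> T0 \<Longrightarrow> P (\<sigma> t a) / t < \<eta>" by (auto simp: eventually_at_top_linorder)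
  \<comment> \<open>From \<open>T\<close> on, rounding \<open>t\<close> to 0 costs at most
    \<open>\<eta> * t\<close>.\<close>
  define T where "T = max T0 1"
  have T: "1 \<le> T" and tail: "P (\<sigma> t a) \<le> \<eta> * t" if "t \<ge> T" for t
    using that T0 [of t] by (auto simp: T_def divide_simps split: if_splits)
  \<comment> \<open>The interval reaches to \<open>T + 1\<close> because the last cell of the grid
    may overshoot \<open>T\<close>.\<close>
  obtain d where "0 < d" and d: "\<And>s t. \<lbrakk>0 \<le> s; s \<le> T + 1; 0 \<le> t; \<bar>t - s\<bar> < d\<rbrakk> \<Longrightarrow> P (\<sigma> t a - \<sigma> s a) < \<eta>"
    using orbit_uniformly_continuous [OF cont \<open>0 < \<eta>\<close>, of "T + 1"] by blast
  \<comment> \<open>Consecutive grid points lie in adjacent cells, so rounding within the grid moves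
    a scalar by less than \<open>2 * \<delta>\<close>; the bound by 1 keeps the \<open>K\<close>
    cells below \<open>T + 1\<close>.\<close>
  define \<delta> where "\<delta> = min (d / 2) 1"
  have \<delta>: "0 < \<delta>" "2 * \<delta> \<le> d" "\<delta> \<le> 1" using \<open>0 < d\<close> by (auto simp: \<delta>_def)
  define K where "K = nat \<lceil>T / \<delta>\<rceil>"
  have "1 \<le> T" by (simp add: T_def)
  then have "T / \<delta> \<le> real K" "real K \<le> T / \<delta> + 1"
    using \<delta>(1) unfolding K_def by (auto simp: of_nat_nat)
  then have K: "T \<le> real K * \<delta>" "real K * \<delta> \<le> T + 1"
    using \<delta> by (auto simp: field_simps)
  \<comment> \<open>One point in each open cell; its position there stays free, to be fitted to
    \<open>V\<close> later.\<close>
  define grid where "grid x \<longleftrightarrow> (\<forall>k. real k * \<delta> < x k \<and> x k < real (Suc k) * \<delta>)" for x :: "nat \<Rightarrow> real"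
  have grid_mono: "strict_mono x" if "grid x" for x
    using that unfolding strict_mono_Suc_iff grid_def by (meson order.strict_trans)
  have grid_0: "0 < x 0" if "grid x" for x using that unfolding grid_def by (metis mult_zero_left of_nat_0)
  have grid_pos: "0 < x k" if "grid x" for x k
    using that \<delta>(1) unfolding grid_def by (meson le_less_trans mult_nonneg_nonneg of_nat_0_le_iff less_imp_le)
  have err: "P (\<sigma> (max 0 t) a - \<sigma> (max 0 (snap x K t)) a) \<le> \<eta> * max t 1" if x: "grid x" for x t
    using grid_mono [OF x]
  proof (cases rule: snap_cases [where K = K and t = t])
    case (cell k)
    have *: "real k * \<delta> < x k" "x (Suc k) < real (Suc (Suc k)) * \<delta>" "x k < real (Suc k) * \<delta>"
      using x unfolding grid_def by blast+
    have "real (Suc k) * \<delta> \<le> real K * \<delta>" using \<open>k < K\<close> \<delta>(1) by (intro mult_right_mono) auto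
    then have "x k \<le> T + 1" using * K by linarith
    moreover have "\<bar>t - x k\<bar> < d" using * cell \<delta> by (simp add: algebra_simps)
    ultimately have "P (\<sigma> t a - \<sigma> (x k) a) < \<eta>"
      using d [of "x k" t] grid_pos [OF x, of k] cell by simp
    also have "\<eta> \<le> \<eta> * max t 1" using \<open>0 < \<eta>\<close> by simp
    finally show ?thesis using cell grid_pos [OF x, of k] by (simp add: max_def)
  next
    case low
    have "x 0 < real (Suc 0) * \<delta>" using x unfolding grid_def by blast
    then have "x 0 < \<delta>" by simp
    then have "\<bar>max 0 t - 0\<bar> < d" using low \<delta> by auto
    then have "P (\<sigma> (max 0 t) a - \<sigma> 0 a) < \<eta>" using d [of 0 "max 0 t"] T_def by simp
    also have "\<eta> \<le> \<eta> * max t 1" using \<open>0 < \<eta>\<close> by simp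
    finally show ?thesis using low by simp
  next
    case high
    have "real K * \<delta> < x K" using x unfolding grid_def by blast
    then have "T \<le> t" using high K by linarith
    then have "P (\<sigma> t a - \<sigma> 0 a) \<le> \<eta> * t" using diff_le [of "\<sigma> t a" "\<sigma> 0 a"] tail [of t] act_null by simp
    moreover have "max 0 t = t" "max t 1 = t" using \<open>T \<le> t\<close> \<open>1 \<le> T\<close> by simp_all
    ultimately show ?thesis using high(2) by simp
  qed
  define R where "R x = frag_extend (\<lambda>t. frag_of (snap x K t))" for x
  \<comment> \<open>Rounding goes down or to 0, so it never raises \<open>max t 1\<close>.\<close>
  have snap_le: "N (R x V) \<le> N V" if x: "grid x" for x V
    unfolding R_def N_def
  proof (rule frag_norm_extend_le)
    fix t
    from grid_mono [OF x] show "frag_norm (\<lambda>t. max t 1) (frag_of (snap x K t)) \<le> max t 1"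
      unfolding frag_norm_of by (cases rule: snap_cases [where K = K and t = t]) auto
  qed simp
  have main: "P (orbit a V) \<le> \<eta> * N V
      + (\<Sum>y\<in>Poly_Mapping.keys (R x V). P (frag_cmul (Poly_Mapping.lookup (R x V) y) (\<sigma> (max 0 y) a)))"
    if "grid x" for x V
    using orbit_snap_le [of a "snap x K" \<eta> V] err [OF that] unfolding R_def N_def by blast
  have keysR: "Poly_Mapping.keys (R x V) \<subseteq> insert 0 (x ` {..<K})" if x: "grid x" for x V
  proof -
    have "snap x K t \<in> insert 0 (x ` {..<K})" for t
      using grid_mono [OF x] by (cases rule: snap_cases [where K = K and t = t]) auto
    then show ?thesis unfolding R_def by (intro order_trans [OF keys_frag_extend]) auto
  qed
  have "\<forall>y. \<exists>C\<ge>0. \<forall>c. P (frag_cmul c (\<sigma> (max 0 y) a)) \<le> C + \<eta> * \<bar>real_of_int c\<bar>"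
    using finite_bound [OF slow_nat \<open>0 < \<eta>\<close>] by metis
  then obtain C where C: "\<And>y. 0 \<le> C y"
    "\<And>y c. P (frag_cmul c (\<sigma> (max 0 y) a)) \<le> C y + \<eta> * \<bar>real_of_int c\<bar>" by metis
  \<comment> \<open>The midpoints: a grid chosen before \<open>V\<close>, so that the constants
    \<open>C\<close> at its finitely many points sum to an \<open>M\<close> valid for all
    \<open>V\<close>.\<close>
  define x0 where "x0 k = (real k + 1/2) * \<delta>" for k
  have x0: "grid x0" using \<delta>(1) by (simp add: grid_def x0_def)
  define M where "M = sum C (insert 0 (x0 ` {..<K}))"
  have "0 \<le> M" using C(1) by (simp add: M_def sum_nonneg)
  have bdd: "P (orbit a V) \<le> \<epsilon> * N V + M" for V
  proof -
    let ?W = "R x0 V"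
    have "(\<Sum>y\<in>Poly_Mapping.keys ?W. P (frag_cmul (Poly_Mapping.lookup ?W y) (\<sigma> (max 0 y) a)))
        \<le> (\<Sum>y\<in>Poly_Mapping.keys ?W. C y + \<eta> * (\<bar>real_of_int (Poly_Mapping.lookup ?W y)\<bar> * max y 1))"
    proof (rule sum_mono)
      fix y
      have "\<bar>real_of_int (Poly_Mapping.lookup ?W y)\<bar> * 1 \<le> \<bar>real_of_int (Poly_Mapping.lookup ?W y)\<bar> * max y 1"
        by (intro mult_left_mono) auto
      then show "P (frag_cmul (Poly_Mapping.lookup ?W y) (\<sigma> (max 0 y) a))
          \<le> C y + \<eta> * (\<bar>real_of_int (Poly_Mapping.lookup ?W y)\<bar> * max y 1)"
        using C(2) [of "Poly_Mapping.lookup ?W y" y] \<open>0 < \<eta>\<close>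
        by (smt (verit) mult_left_mono mult.right_neutral)
    qed
    also have "\<dots> = sum C (Poly_Mapping.keys ?W) + \<eta> * N ?W"
      by (simp add: sum.distrib N_def frag_norm_def sum_distrib_left)
    also have "\<dots> \<le> M + \<eta> * N V"
      unfolding M_def using snap_le [OF x0, of V] \<open>0 < \<eta>\<close> C(1) keysR [OF x0]
      by (intro add_mono sum_mono2 mult_left_mono) auto
    finally show ?thesis using main [OF x0, of V] by (simp add: \<eta>_def)
  qed
  have short: "P (orbit a V) \<le> \<epsilon> * N V" if V: "switch_len n V < \<delta>" for V
  proof -
    \<comment> \<open>Otherwise the whole cell, of length \<open>\<delta>\<close>, would lie in the
      support, whose measure is less than \<open>\<delta>\<close>.\<close>
    have "\<exists>y. real k * \<delta> < y \<and> y < real (Suc k) * \<delta> \<and> y \<notin> switch_set n V" for k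
    proof (rule ccontr)
      assume "\<not> ?thesis"
      then have "{real k * \<delta><..<real (Suc k) * \<delta>} \<subseteq> switch_set n V" by auto
      then have "measure lebesgue {real k * \<delta><..<real (Suc k) * \<delta>} \<le> switch_len n V"
        unfolding switch_len_def by (rule measure_mono_fmeasurable) (auto simp: switch_set_lmeasurable)
      then show False using V \<delta>(1) by (simp add: algebra_simps)
    qed
    then obtain x where x: "\<And>k. real k * \<delta> < x k \<and> x k < real (Suc k) * \<delta> \<and> x k \<notin> switch_set n V"
      by metis
    then have "grid x" by (simp add: grid_def)
    have dvd: "int n dvd cum V (x k)" for k
      using x [of k] grid_pos [OF \<open>grid x\<close>, of k] by (simp add: switch_set_def)
    let ?W = "R x V"
    have "(\<Sum>y\<in>Poly_Mapping.keys ?W. P (frag_cmul (Poly_Mapping.lookup ?W y) (\<sigma> (max 0 y) a)))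
        \<le> (\<Sum>y\<in>Poly_Mapping.keys ?W. \<eta> * (\<bar>real_of_int (Poly_Mapping.lookup ?W y)\<bar> * max y 1))"
    proof (rule sum_mono)
      fix y assume "y \<in> Poly_Mapping.keys ?W"
      then consider "y = 0" | k where "k < K" "y = x k" using keysR [OF \<open>grid x\<close>] by auto
      then show "P (frag_cmul (Poly_Mapping.lookup ?W y) (\<sigma> (max 0 y) a))
          \<le> \<eta> * (\<bar>real_of_int (Poly_Mapping.lookup ?W y)\<bar> * max y 1)"
      proof cases
        case 1
        \<comment> \<open>The coefficient collected at 0 may be arbitrary, as it multiplies the null
          element \<open>\<sigma> 0 a\<close>.\<close>
        then show ?thesis
          using frag_cmul_le [of "Poly_Mapping.lookup ?W y" "\<sigma> 0 a"] act_null [of a] \<open>0 < \<eta>\<close>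
          by (simp add: order_trans [OF _ mult_nonneg_nonneg])
      next
        case 2
        have "int n dvd Poly_Mapping.lookup ?W y"
          unfolding 2 R_def lookup_snap [OF grid_mono grid_0 \<open>k < K\<close>, OF \<open>grid x\<close> \<open>grid x\<close>]
          by (intro dvd_diff dvd)
        then obtain j where j: "Poly_Mapping.lookup ?W y = int n * j" by (auto simp: dvd_def)
        have "0 \<le> y" using 2 grid_pos [OF \<open>grid x\<close>, of k] by simp
        \<comment> \<open>The action commutes with integer multiples, so \<open>tors\<close> is
          applied to \<open>a\<close> itself and the scalar costs only
          \<open>max y 1\<close>.\<close>
        then have "P (frag_cmul (int n * j) (\<sigma> y a)) \<le> max y 1 * P (frag_cmul (int n * j) a)"
          using act_le [of y "frag_cmul (int n * j) a"] by (simp add: act_frag_cmul)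
        also have "\<dots> \<le> max y 1 * (\<eta> * \<bar>real_of_int (int n * j)\<bar>)"
          using tors [of j] by (intro mult_left_mono) (auto simp: \<eta>_def)
        finally show ?thesis using \<open>0 \<le> y\<close> unfolding j by (simp add: algebra_simps)
      qed
    qed
    also have "\<dots> = \<eta> * N ?W"
      by (simp add: N_def frag_norm_def sum_distrib_left)
    also have "\<dots> \<le> \<eta> * N V"
      using snap_le [OF \<open>grid x\<close>, of V] \<open>0 < \<eta>\<close> by simp
    finally show ?thesis using main [OF \<open>grid x\<close>, of V] by (simp add: \<eta>_def)
  qed
  \<comment> \<open>With this slope \<open>L * switch_len n V\<close> is at least \<open>M\<close>
    as soon as the switching length is at least \<open>\<delta>\<close>.\<close>
  define L where "L = M / \<delta>"
  have "0 \<le> L" using \<open>0 \<le> M\<close> \<delta>(1) by (simp add: L_def)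
  have "P (orbit a V) \<le> \<epsilon> * N V + min M (L * switch_len n V)" for V
  proof (cases "switch_len n V < \<delta>")
    case True
    then show ?thesis using short [of V] \<open>0 \<le> M\<close> \<open>0 \<le> L\<close> by (simp add: add_increasing2)
  next
    case False
    then have "M \<le> L * switch_len n V"
      using \<delta>(1) \<open>0 \<le> M\<close> mult_left_mono [of \<delta> "switch_len n V" M] by (simp add: L_def field_simps)
    then show ?thesis using bdd [of V] by simp
  qed
  then show ?thesis using that \<open>0 \<le> M\<close> \<open>0 \<le> L\<close> unfolding N_def by blast
qed

end

section \<open>Adjoining combinations of finite-order generators\<close>

text \<open>The generator \<open>(i, t)\<close> stands for \<open>t\<close> times the adjoined
  element with index \<open>i\<close>; a slice collects the scalars belonging to one such
  element.\<close>

definition slice :: "'i \<Rightarrow> ('i \<times> real \<Rightarrow>\<^sub>0 int) \<Rightarrow> (real \<Rightarrow>\<^sub>0 int)" where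
  "slice i = frag_extend (\<lambda>(j, t). if j = i then frag_of t else 0)"

definition rescale :: "real \<Rightarrow> ('i \<times> real \<Rightarrow>\<^sub>0 int) \<Rightarrow> ('i \<times> real \<Rightarrow>\<^sub>0 int)" where
  "rescale s = frag_extend (\<lambda>(i, t). frag_of (i, s * t))"

definition indices :: "('i \<times> real \<Rightarrow>\<^sub>0 int) \<Rightarrow> 'i set" where
  "indices W = fst ` Poly_Mapping.keys W"

lemma slice_0 [simp]: "slice i 0 = 0"
  by (simp add: slice_def)

lemma slice_add [simp]: "slice i (V + W) = slice i V + slice i W"
  by (simp add: slice_def frag_extend_add)

lemma slice_diff [simp]: "slice i (V - W) = slice i V - slice i W"
  by (simp add: slice_def frag_extend_diff)

lemma slice_minus [simp]: "slice i (- V) = - slice i V"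
  by (simp add: slice_def frag_extend_minus)

lemma slice_cmul [simp]: "slice i (frag_cmul c V) = frag_cmul c (slice i V)"
  by (simp add: slice_def frag_extend_cmul)

lemma slice_of [simp]: "slice i (frag_of (j, t)) = (if j = i then frag_of t else 0)"
  by (simp add: slice_def)

lemma lookup_slice: "Poly_Mapping.lookup (slice i W) t = Poly_Mapping.lookup W (i, t)"
  using subset_UNIV
proof (induction W rule: frag_induction)
  case (one k)
  then show ?case by (cases k rule: prod.exhaust) (auto split: if_split_asm)
qed (auto simp: lookup_minus)

lemma finite_indices [simp]: "finite (indices W)"
  by (simp add: indices_def)

lemma slice_outside: "i \<notin> indices W \<Longrightarrow> slice i W = 0"
  by (rule poly_mapping_eqI) (force simp: lookup_slice indices_def in_keys_iff)

lemma indices_0 [simp]: "indices 0 = {}"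
  by (simp add: indices_def)

lemma indices_of [simp]: "indices (frag_of (i, t)) = {i}"
  by (simp add: indices_def)

lemma indices_minus [simp]: "indices (- V) = indices V"
  by (simp add: indices_def)

lemma indices_add: "indices (V + W) \<subseteq> indices V \<union> indices W"
  using keys_add [of V W] by (auto simp: indices_def)

lemma indices_diff: "indices (V - W) \<subseteq> indices V \<union> indices W"
  using keys_diff [of V W] by (auto simp: indices_def)

lemma indices_rescale: "indices (rescale s W) \<subseteq> indices W"
  using keys_frag_extend [of "\<lambda>(i, t). frag_of (i, s * t)" W]
  by (force simp: indices_def rescale_def)

lemma slice_rescale: "slice i (rescale s W) = dilate s (slice i W)"
  unfolding rescale_def dilate_def using subset_UNIV
  by (induction W rule: frag_induction) (auto simp: frag_extend_diff)

lemma rescale_add: "rescale s (V + W) = rescale s V + rescale s W"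
  by (simp add: rescale_def frag_extend_add)

lemma rescale_diff: "rescale s (V - W) = rescale s V - rescale s W"
  by (simp add: rescale_def frag_extend_diff)

lemma rescale_of [simp]: "rescale s (frag_of (i, t)) = frag_of (i, s * t)"
  by (simp add: rescale_def)

lemma rescale_1: "rescale 1 W = W"
  unfolding rescale_def using subset_UNIV
  by (induction W rule: frag_induction) (auto simp: frag_extend_diff)

lemma rescale_rescale: "rescale s (rescale t W) = rescale (s * t) W"
  unfolding rescale_def using subset_UNIV
  by (induction W rule: frag_induction) (auto simp: frag_extend_diff mult.assoc)

lemma frag_norm_slices:
  "frag_norm w W = (\<Sum>i\<in>indices W. frag_norm (\<lambda>t. w (i, t)) (slice i W))"
proof -
  define T where "T = snd ` Poly_Mapping.keys W"
  have keys: "Poly_Mapping.keys W \<subseteq> indices W \<times> T"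
    by (force simp: indices_def T_def)
  have slice: "Poly_Mapping.keys (slice i W) \<subseteq> T" for i
    by (force simp: T_def in_keys_iff lookup_slice)
  have fin: "finite T" by (simp add: T_def)
  have "frag_norm w W = (\<Sum>k\<in>indices W \<times> T. \<bar>real_of_int (Poly_Mapping.lookup W k)\<bar> * w k)"
    using keys fin by (intro frag_norm_superset) auto
  also have "\<dots> = (\<Sum>i\<in>indices W. \<Sum>t\<in>T. \<bar>real_of_int (Poly_Mapping.lookup W (i, t))\<bar> * w (i, t))"
    by (simp add: sum.cartesian_product)
  also have "\<dots> = (\<Sum>i\<in>indices W. frag_norm (\<lambda>t. w (i, t)) (slice i W))"
    by (simp add: frag_norm_superset [OF fin slice] lookup_slice)
  finally show ?thesis .
qed

text \<open>\<open>bound\<close> is the conclusion of \<open>orbit_bound\<close> for each adjoined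
  element. The norm of a combination of the \<open>t * b\<close>, plus the price of replacing each
  \<open>t * b\<close> by \<open>t * a\<close>, covers the norm of the replaced combination, so the
  replacement cannot shrink \<open>P\<close>.\<close>

locale pvg_extension = frag_pvg P \<sigma> for P :: "('x \<Rightarrow>\<^sub>0 int) \<Rightarrow> real" and \<sigma> +
  fixes a :: "'i \<Rightarrow> ('x \<Rightarrow>\<^sub>0 int)" and \<epsilon> :: "'i \<Rightarrow> real" and order :: "'i \<Rightarrow> nat"
    and M L :: "'i \<Rightarrow> real"
  assumes \<epsilon>_pos: "0 < \<epsilon> i" and order_pos: "0 < order i"
    and M_nonneg: "0 \<le> M i" and L_nonneg: "0 \<le> L i"
    and bound: "P (orbit (a i) V)
      \<le> \<epsilon> i * frag_norm (\<lambda>t. max t 1) V + min (M i) (L i * switch_len (order i) V)"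
begin

definition gen_norm :: "'i \<Rightarrow> (real \<Rightarrow>\<^sub>0 int) \<Rightarrow> real" where
  "gen_norm i V = min (M i) (L i * switch_len (order i) V)"

definition total_norm :: "('i \<times> real \<Rightarrow>\<^sub>0 int) \<Rightarrow> real" where
  "total_norm W = (\<Sum>i\<in>indices W. gen_norm i (slice i W))"

definition weight :: "('i \<times> real \<Rightarrow>\<^sub>0 int) \<Rightarrow> real" where
  "weight = frag_norm (\<lambda>(i, t). \<epsilon> i * max t 1)"

definition orbits :: "('i \<times> real \<Rightarrow>\<^sub>0 int) \<Rightarrow> ('x \<Rightarrow>\<^sub>0 int)" where
  "orbits = frag_extend (\<lambda>(i, t). \<sigma> (max 0 t) (a i))"

text \<open>The price of the splitting
  \<open>(x, W) = (x + orbits V, 0) + (- orbits V, V) + (0, W - V)\<close>. The middle term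
  exchanges generators for the vectors that they approximate and is charged by
  \<open>weight\<close>.\<close>

definition ext_cost :: "('x \<Rightarrow>\<^sub>0 int) \<Rightarrow> ('i \<times> real \<Rightarrow>\<^sub>0 int) \<Rightarrow> ('i \<times> real \<Rightarrow>\<^sub>0 int) \<Rightarrow> real" where
  "ext_cost x W V = P (x + orbits V) + weight V + total_norm (W - V)"

text \<open>The largest pseudonorm below \<^term>\<open>P\<close> on the first and \<^term>\<open>total_norm\<close> on the second
  factor that makes \<^term>\<open>\<sigma> t (a i)\<close> and the generator \<^term>\<open>frag_of (i, t)\<close> at most
  \<^term>\<open>\<epsilon> i * max t 1\<close> apart.\<close>

definition ext_norm :: "('x \<Rightarrow>\<^sub>0 int) \<times> ('i \<times> real \<Rightarrow>\<^sub>0 int) \<Rightarrow> real" where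
  "ext_norm = (\<lambda>(x, W). INF V. ext_cost x W V)"

definition ext_act :: "real \<Rightarrow> ('x \<Rightarrow>\<^sub>0 int) \<times> ('i \<times> real \<Rightarrow>\<^sub>0 int) \<Rightarrow> ('x \<Rightarrow>\<^sub>0 int) \<times> ('i \<times> real \<Rightarrow>\<^sub>0 int)" where
  "ext_act t = (\<lambda>(x, W). (\<sigma> t x, rescale t W))"

lemma pseudonorm_gen_norm: "pseudonorm (gen_norm i)"
proof -
  interpret len: pseudonorm "switch_len (order i)" by (rule pseudonorm_switch_len)
  have "pseudonorm (\<lambda>V. L i * switch_len (order i) V)"
    by unfold_locales (auto simp: L_nonneg distrib_left [symmetric] intro!: mult_left_mono len.triangle)
  from pseudonorm_min [OF this M_nonneg] show ?thesis
    unfolding gen_norm_def min.commute [of "M i"] .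
qed

lemma gen_norm_0 [simp]: "gen_norm i 0 = 0"
  using pseudonorm.zero [OF pseudonorm_gen_norm] .

text \<open>The length term is multiplied by \<open>s\<close> and the cap by 1, both at most
  \<open>max s 1\<close>.\<close>

lemma gen_norm_dilate_le:
  assumes "0 \<le> s"
  shows "gen_norm i (dilate s V) \<le> max s 1 * gen_norm i V"
proof -
  have "gen_norm i (dilate s V) \<le> min (max s 1 * M i) (max s 1 * (L i * switch_len (order i) V))"
    unfolding gen_norm_def switch_len_dilate [OF assms]
  proof (rule min.mono)
    show "M i \<le> max s 1 * M i"
      using mult_right_mono [of 1 "max s 1" "M i"] M_nonneg [of i] by simp
    have "s * (L i * switch_len (order i) V) \<le> max s 1 * (L i * switch_len (order i) V)"
      using L_nonneg [of i] by (intro mult_right_mono) auto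
    then show "L i * (s * switch_len (order i) V) \<le> max s 1 * (L i * switch_len (order i) V)"
      by (simp only: mult.left_commute)
  qed
  moreover have "0 \<le> max s 1" by simp
  ultimately show ?thesis unfolding gen_norm_def min_mult_distrib_left by (simp only: if_True)
qed

lemma gen_norm_dilate_0: "gen_norm i (dilate 0 V) = 0"
  using M_nonneg [of i] by (simp add: gen_norm_def switch_len_dilate min_def)

lemma total_norm_superset:
  assumes "finite I" "indices W \<subseteq> I"
  shows "total_norm W = (\<Sum>i\<in>I. gen_norm i (slice i W))"
  unfolding total_norm_def
  by (rule sum.mono_neutral_left) (use assms in \<open>auto simp: slice_outside\<close>)

lemma pseudonorm_total_norm: "pseudonorm total_norm"
proof
  show "total_norm (V + W) \<le> total_norm V + total_norm W" for V W
  proof -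
    let ?I = "indices V \<union> indices W"
    have "total_norm (V + W) = (\<Sum>i\<in>?I. gen_norm i (slice i (V + W)))"
      by (rule total_norm_superset) (simp_all add: indices_add)
    also have "\<dots> \<le> (\<Sum>i\<in>?I. gen_norm i (slice i V) + gen_norm i (slice i W))"
      by (auto intro!: sum_mono pseudonorm.triangle [OF pseudonorm_gen_norm])
    also have "\<dots> = total_norm V + total_norm W"
      by (simp add: sum.distrib total_norm_superset [of ?I])
    finally show ?thesis .
  qed
qed (simp_all add: total_norm_def pseudonorm.minus [OF pseudonorm_gen_norm])

sublocale total: pseudonorm total_norm
  by (rule pseudonorm_total_norm)

lemma total_norm_rescale_le:
  assumes "0 \<le> s"
  shows "total_norm (rescale s W) \<le> max s 1 * total_norm W"
proof -
  have "total_norm (rescale s W) = (\<Sum>i\<in>indices W. gen_norm i (slice i (rescale s W)))"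
    by (rule total_norm_superset) (simp_all add: indices_rescale)
  also have "\<dots> \<le> (\<Sum>i\<in>indices W. max s 1 * gen_norm i (slice i W))"
    unfolding slice_rescale by (intro sum_mono gen_norm_dilate_le assms)
  finally show ?thesis by (simp add: total_norm_def sum_distrib_left)
qed

lemma total_norm_rescale_0: "total_norm (rescale 0 W) = 0"
  by (simp add: total_norm_def slice_rescale gen_norm_dilate_0)

lemma total_norm_le_M:
  assumes "finite I" "indices W \<subseteq> I"
  shows "total_norm W \<le> sum M I"
  unfolding total_norm_superset [OF assms] by (intro sum_mono) (simp add: gen_norm_def)

lemma total_norm_cmul:
  assumes "\<And>i. i \<in> indices W \<Longrightarrow> order i dvd n"
  shows "total_norm (frag_cmul (int n) W) = 0"
proof -
  have "indices (frag_cmul (int n) W) \<subseteq> indices W"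
    using keys_cmul [of "int n" W] by (auto simp: indices_def)
  then have "total_norm (frag_cmul (int n) W) = (\<Sum>i\<in>indices W. gen_norm i (slice i (frag_cmul (int n) W)))"
    by (intro total_norm_superset) auto
  also have "\<dots> = 0"
    using assms M_nonneg by (intro sum.neutral) (simp add: gen_norm_def switch_len_cmul)
  finally show ?thesis .
qed

lemma total_norm_step_le: "total_norm (frag_of (i, s) - frag_of (i, t)) \<le> L i * \<bar>s - t\<bar>"
proof -
  have "total_norm (frag_of (i, s) - frag_of (i, t)) = gen_norm i (frag_of s - frag_of t)"
    using total_norm_superset [of "{i}"] indices_diff [of "frag_of (i, s)" "frag_of (i, t)"] by simp
  also have "\<dots> \<le> L i * \<bar>s - t\<bar>"
    unfolding gen_norm_def using L_nonneg [of i]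
    by (intro min.coboundedI2 mult_left_mono switch_len_step_le)
  finally show ?thesis .
qed

sublocale weight: frag_pseudonorm weight
  unfolding weight_def by (rule frag_pseudonorm_frag_norm) (auto simp: less_imp_le [OF \<epsilon>_pos])

lemma weight_of [simp]: "weight (frag_of (i, t)) = \<epsilon> i * max t 1"
  by (simp add: weight_def)

text \<open>Weights of the form \<open>max t 1\<close> fit a subnorm because
  \<open>max (s * t) 1 \<le> max s 1 * max t 1\<close>.\<close>

lemma weight_rescale_le:
  assumes "0 \<le> s"
  shows "weight (rescale s V) \<le> max s 1 * weight V"
proof -
  have "weight (rescale s V) \<le> frag_norm (\<lambda>k. max s 1 * (case k of (i, t) \<Rightarrow> \<epsilon> i * max t 1)) V"
    unfolding weight_def rescale_def
  proof (rule frag_norm_extend_le)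
    fix k :: "'i \<times> real"
    obtain i t where k: "k = (i, t)" by (cases k)
    have "s * t \<le> max s 1 * max t 1"
      by (rule order_trans [OF mult_left_mono mult_right_mono, of t "max t 1" s "max s 1"]) (use assms in auto)
    moreover have "1 \<le> max s 1 * max t 1" using mult_mono [of 1 "max s 1" 1 "max t 1"] by simp
    ultimately have "\<epsilon> i * max (s * t) 1 \<le> \<epsilon> i * (max s 1 * max t 1)"
      using \<epsilon>_pos [of i] by (intro mult_left_mono) auto
    then show "frag_norm (\<lambda>(i, t). \<epsilon> i * max t 1) (case k of (i, t) \<Rightarrow> frag_of (i, s * t))
        \<le> max s 1 * (case k of (i, t) \<Rightarrow> \<epsilon> i * max t 1)"
      by (simp add: k algebra_simps)
  qed (auto simp: less_imp_le [OF \<epsilon>_pos])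
  then show ?thesis by (simp add: frag_norm_mult weight_def)
qed

lemma orbits_add: "orbits (V + W) = orbits V + orbits W"
  by (simp add: orbits_def frag_extend_add)

lemma orbits_diff: "orbits (V - W) = orbits V - orbits W"
  by (simp add: orbits_def frag_extend_diff)

lemma orbits_minus: "orbits (- V) = - orbits V"
  by (simp add: orbits_def frag_extend_minus)

lemma orbits_0 [simp]: "orbits 0 = 0"
  by (simp add: orbits_def)

lemma orbits_of [simp]: "orbits (frag_of (i, t)) = \<sigma> (max 0 t) (a i)"
  by (simp add: orbits_def)

lemma orbits_rescale:
  assumes "0 \<le> s"
  shows "P (orbits (rescale s V) - \<sigma> s (orbits V)) = 0"
  using subset_UNIV
proof (induction V rule: frag_induction)
  case (one k)
  obtain i t where k: "k = (i, t)" by (cases k)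
  have "max 0 (s * t) = s * max 0 t"
    using assms mult_nonneg_nonpos [of s t] by (cases "0 \<le> t") (simp_all add: max_absorb1)
  then show ?case using act_mult [of s "max 0 t" "a i"] assms by (simp add: k)
next
  case (diff V W)
  have "orbits (rescale s (V - W)) - \<sigma> s (orbits (V - W))
      = (orbits (rescale s V) - \<sigma> s (orbits V)) - (orbits (rescale s W) - \<sigma> s (orbits W))"
    using assms by (simp add: rescale_diff orbits_diff act_diff)
  then show ?case
    using diff diff_le [of "orbits (rescale s V) - \<sigma> s (orbits V)" "orbits (rescale s W) - \<sigma> s (orbits W)"]
    by (simp add: order_antisym)
qed (use assms in \<open>simp_all add: rescale_def\<close>)

lemma orbits_slices: "orbits W = (\<Sum>i\<in>indices W. orbit (a i) (slice i W))"
proof -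
  \<comment> \<open>The index set stays that of \<open>W\<close> while the induction runs over
    \<open>V\<close>, whose own index set would change along the way.\<close>
  have "orbits V = (\<Sum>i\<in>indices W. orbit (a i) (slice i V))"
    if "Poly_Mapping.keys V \<subseteq> indices W \<times> UNIV" for V
    using that
  proof (induction V rule: frag_induction)
    case (one k)
    then obtain i t where k: "k = (i, t)" and "i \<in> indices W" by auto
    have "(\<Sum>j\<in>indices W. orbit (a j) (slice j (frag_of k)))
        = (\<Sum>j\<in>indices W. if j = i then \<sigma> (max 0 t) (a i) else 0)"
      by (rule sum.cong) (auto simp: k orbit_def)
    then show ?case using \<open>i \<in> indices W\<close> by (simp add: k)
  qed (simp_all add: orbit_def orbits_diff frag_extend_diff sum_subtractf)
  moreover have "Poly_Mapping.keys W \<subseteq> indices W \<times> UNIV" by (force simp: indices_def)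
  ultimately show ?thesis by blast
qed

lemma orbits_le: "P (orbits W) \<le> weight W + total_norm W"
proof -
  have "P (orbits W) \<le> (\<Sum>i\<in>indices W. P (orbit (a i) (slice i W)))"
    unfolding orbits_slices by (rule sum_le)
  also have "\<dots> \<le> (\<Sum>i\<in>indices W. frag_norm (\<lambda>t. \<epsilon> i * max t 1) (slice i W) + gen_norm i (slice i W))"
    unfolding frag_norm_mult gen_norm_def by (intro sum_mono bound)
  also have "\<dots> = weight W + total_norm W"
    by (simp add: sum.distrib total_norm_def weight_def frag_norm_slices [of _ W])
  finally show ?thesis .
qed

section \<open>The norm on the extension\<close>

lemma ext_norm_le: "ext_norm (x, W) \<le> ext_cost x W V"
  unfolding ext_norm_def case_prod_conv
  by (rule cINF_lower) (auto intro!: bdd_belowI2 [of _ 0] simp: ext_cost_def)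

lemma ext_norm_ge: "(\<And>V. c \<le> ext_cost x W V) \<Longrightarrow> c \<le> ext_norm (x, W)"
  unfolding ext_norm_def case_prod_conv by (rule cINF_greatest) auto

lemma ext_norm_le_P: "ext_norm (x, 0) \<le> P x"
  using ext_norm_le [of x 0 0] by (simp add: ext_cost_def)

lemma ext_norm_le_total: "ext_norm (0, W) \<le> total_norm W"
  using ext_norm_le [of 0 W 0] by (simp add: ext_cost_def)

text \<open>This is where \<open>bound\<close> enters, through \<open>orbits_le\<close>: undoing an
  exchange \<open>V\<close> costs at most \<open>weight V + total_norm V\<close>, which
  \<open>ext_cost x 0 V\<close> charges besides \<open>P (x + orbits V)\<close>. So no detour beats
  \<open>V = 0\<close>.\<close>

lemma ext_norm_eq: "ext_norm (x, 0) = P x"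
proof (rule order_antisym [OF ext_norm_le_P ext_norm_ge])
  fix V
  have "P x \<le> P (x + orbits V) + P (orbits V)" using diff_le [of "x + orbits V" "orbits V"] by simp
  then show "P x \<le> ext_cost x 0 V" using orbits_le [of V] by (simp add: ext_cost_def)
qed

text \<open>Exchanging the whole second component leaves the null element
  \<open>a i - \<sigma> 1 (a i)\<close> and the weight of one generator with scalar 1.\<close>

lemma ext_norm_gen_le: "ext_norm (a i, - frag_of (i, 1)) \<le> \<epsilon> i"
  using ext_norm_le [of "a i" "- frag_of (i, 1)" "- frag_of (i, 1)"] act_one [of "a i"]
    commute [of "a i" "\<sigma> 1 (a i)"]
  by (simp add: ext_cost_def orbits_minus)

text \<open>\<open>ext_norm\<close> is an infimal convolution: the cost is subadditive in
  \<open>(x, W, V)\<close> jointly and even under negation, and both properties survive the infimum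
  over \<open>V\<close>.\<close>

lemma pseudonorm_ext_norm: "pseudonorm ext_norm"
proof
  have nonneg: "0 \<le> ext_norm x" for x
    by (cases x) (auto intro!: ext_norm_ge simp: ext_cost_def)
  show "ext_norm 0 = 0"
    using ext_norm_eq [of 0] by (simp add: zero_prod_def)
  have "ext_norm (- x) \<le> ext_norm x" for x
  proof (cases x)
    case (Pair y W)
    have "ext_norm (- y, - W) \<le> ext_cost y W V" for V
    proof -
      have "ext_cost (- y) (- W) (- V) = ext_cost y W V"
        unfolding ext_cost_def
        using minus [of "y + orbits V"] total.minus [of "W - V"] by (simp add: orbits_minus)
      then show ?thesis using ext_norm_le [of "- y" "- W" "- V"] by simp
    qed
    then show ?thesis by (simp add: Pair ext_norm_ge)
  qed
  then show "ext_norm (- x) = ext_norm x" for x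
    using order_antisym minus_minus by metis
  show "ext_norm (x + y) \<le> ext_norm x + ext_norm y" for x y
  proof -
    obtain g W h U where xy: "x = (g, W)" "y = (h, U)" by (cases x, cases y)
    have *: "ext_norm (x + y) \<le> ext_cost g W V + ext_cost h U V'" for V V'
    proof -
      have "ext_norm (x + y) \<le> ext_cost (g + h) (W + U) (V + V')"
        unfolding xy using ext_norm_le by simp
      also have "\<dots> \<le> ext_cost g W V + ext_cost h U V'"
        unfolding ext_cost_def
        using triangle [of "g + orbits V" "h + orbits V'"] weight.triangle [of V V']
          total.triangle [of "W - V" "U - V'"]
        by (simp add: orbits_add algebra_simps)
      finally show ?thesis .
    qed
    then have "ext_norm (x + y) - ext_cost g W V \<le> ext_norm y" for V
      unfolding xy(2) by (intro ext_norm_ge) (simp add: algebra_simps)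
    then have "ext_norm (x + y) - ext_norm y \<le> ext_norm x"
      unfolding xy(1) by (intro ext_norm_ge) (simp add: algebra_simps)
    then show ?thesis by simp
  qed
qed

sublocale ext: pseudo_pvg ext_norm ext_act
proof -
  interpret e: pseudonorm ext_norm by (rule pseudonorm_ext_norm)
  show "pseudo_pvg ext_norm ext_act"
  proof
    fix t :: real and x y :: "('x \<Rightarrow>\<^sub>0 int) \<times> ('i \<times> real \<Rightarrow>\<^sub>0 int)"
    assume "0 \<le> t"
    then show "ext_act t (x + y) = ext_act t x + ext_act t y"
      by (simp add: ext_act_def split_beta act_add rescale_add)
  next
    fix x :: "('x \<Rightarrow>\<^sub>0 int) \<times> ('i \<times> real \<Rightarrow>\<^sub>0 int)"
    obtain g W where x: "x = (g, W)" by (cases x)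
    have "ext_norm (\<sigma> 0 g, rescale 0 W) \<le> 0"
      using ext_norm_le [of "\<sigma> 0 g" "rescale 0 W" 0]
      by (simp add: ext_cost_def total_norm_rescale_0 act_null)
    then show "ext_norm (ext_act 0 x) = 0"
      using e.nonneg by (simp add: x ext_act_def order_antisym)
    show "ext_norm (ext_act 1 x - x) = 0"
      by (simp add: x ext_act_def rescale_1 ext_norm_eq act_one)
    show "ext_norm (ext_act (s * t) x - ext_act s (ext_act t x)) = 0" if "0 \<le> s" "0 \<le> t" for s t
      using that by (simp add: x ext_act_def rescale_rescale ext_norm_eq act_mult)
    show "ext_norm (ext_act t x) \<le> max t 1 * ext_norm x" if "0 \<le> t" for t
    proof -
      \<comment> \<open>A splitting \<open>V\<close> of \<open>x\<close> is turned into the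
        splitting \<open>rescale t V\<close> of the scaled element. Dividing by
        \<open>max t 1\<close> brings the claim into a form to which \<open>ext_norm_ge\<close>
        applies.\<close>
      have "ext_norm (ext_act t x) / max t 1 \<le> ext_cost g W V" for V
      proof -
        have "(\<sigma> t g + orbits (rescale t V)) - \<sigma> t (g + orbits V) = orbits (rescale t V) - \<sigma> t (orbits V)"
          using that by (simp add: act_add)
        then have eq: "P (\<sigma> t g + orbits (rescale t V)) = P (\<sigma> t (g + orbits V))"
          by (intro eq_of_diff_zero) (simp only: orbits_rescale that)
        have "ext_norm (ext_act t x) \<le> ext_cost (\<sigma> t g) (rescale t W) (rescale t V)"
          by (simp add: x ext_act_def ext_norm_le)
        also have "\<dots> \<le> max t 1 * P (g + orbits V) + max t 1 * weight V + max t 1 * total_norm (W - V)"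
          unfolding ext_cost_def eq rescale_diff [symmetric]
          by (intro add_mono act_le weight_rescale_le total_norm_rescale_le that)
        finally show ?thesis by (simp add: ext_cost_def divide_simps algebra_simps)
      qed
      then have "ext_norm (ext_act t x) / max t 1 \<le> ext_norm x"
        unfolding x by (rule ext_norm_ge)
      moreover have "0 < max t 1" by simp
      ultimately show ?thesis by (simp only: pos_divide_le_eq mult.commute)
    qed
  qed
qed

lemma ext_act_eq: "ext_act t (x, W) = (\<sigma> t x, rescale t W)"
  by (simp add: ext_act_def)

text \<open>On a generator \<open>(i, u)\<close> the constant is \<open>L i * \<bar>u\<bar>\<close>,
  and constants add up under differences.\<close>

lemma ext_norm_lipschitz:
  obtains C where "\<And>s t. ext_norm (0, rescale s W - rescale t W) \<le> C * \<bar>s - t\<bar>"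
proof -
  have "\<exists>C. \<forall>s t. total_norm (rescale s W - rescale t W) \<le> C * \<bar>s - t\<bar>"
    using subset_UNIV
  proof (induction W rule: frag_induction)
    case zero
    show ?case by (rule exI [of _ 0]) (simp add: rescale_def)
  next
    case (one k)
    obtain i u where k: "k = (i, u)" by (cases k)
    have "total_norm (rescale s (frag_of k) - rescale t (frag_of k)) \<le> (L i * \<bar>u\<bar>) * \<bar>s - t\<bar>" for s t
      using total_norm_step_le [of i "s * u" "t * u"]
      by (simp add: k left_diff_distrib [symmetric] abs_mult mult.assoc mult.commute [of "\<bar>u\<bar>"])
    then show ?case by blast
  next
    case (diff V W)
    then obtain C D where C: "\<And>s t. total_norm (rescale s V - rescale t V) \<le> C * \<bar>s - t\<bar>"
      and D: "\<And>s t. total_norm (rescale s W - rescale t W) \<le> D * \<bar>s - t\<bar>" by blast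
    have "total_norm (rescale s (V - W) - rescale t (V - W)) \<le> (C + D) * \<bar>s - t\<bar>" for s t
    proof -
      have "rescale s (V - W) - rescale t (V - W)
          = (rescale s V - rescale t V) - (rescale s W - rescale t W)"
        by (simp add: rescale_diff)
      then show ?thesis
        using total.diff_le [of "rescale s V - rescale t V" "rescale s W - rescale t W"] C [of s t] D [of s t]
        by (simp add: distrib_right)
    qed
    then show ?case by blast
  qed
  then show ?thesis using that order_trans [OF ext_norm_le_total] by blast
qed

text \<open>Moving the scalar of one generator costs at most \<open>L i\<close> times the distance
  moved.\<close>

lemma ext_norm_rational_approx:
  assumes "0 < e"
  obtains V where "Poly_Mapping.keys V \<subseteq> UNIV \<times> \<rat>" "ext_norm (0, W - V) < e"
proof -
  have "\<forall>e>0. \<exists>V. Poly_Mapping.keys V \<subseteq> UNIV \<times> \<rat> \<and> total_norm (W - V) < e"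
    using subset_UNIV
  proof (induction W rule: frag_induction)
    case zero
    show ?case by (auto intro: exI [of _ 0])
  next
    case (one k)
    obtain i t where k: "k = (i, t)" by (cases k)
    show ?case
    proof (intro allI impI)
      fix e :: real assume "0 < e"
      \<comment> \<open>Adding 1 covers \<open>L i = 0\<close> and makes the final inequality
        strict.\<close>
      define d where "d = e / (L i + 1)"
      have "0 < d" using \<open>0 < e\<close> L_nonneg [of i] by (simp add: d_def)
      then obtain q where q: "q \<in> \<rat>" "t < q" "q < t + d" using Rats_dense_in_real [of t "t + d"] by auto
      have "total_norm (frag_of (i, t) - frag_of (i, q)) \<le> L i * \<bar>t - q\<bar>" by (rule total_norm_step_le)
      also have "\<dots> \<le> L i * d" using q L_nonneg [of i] by (intro mult_left_mono) auto
      also have "\<dots> < e" using \<open>0 < e\<close> L_nonneg [of i] by (simp add: d_def field_simps)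
      finally show "\<exists>V. Poly_Mapping.keys V \<subseteq> UNIV \<times> \<rat> \<and> total_norm (frag_of k - V) < e"
        using q by (intro exI [of _ "frag_of (i, q)"]) (simp add: k)
    qed
  next
    case (diff U W)
    show ?case
    proof (intro allI impI)
      fix e :: real assume "0 < e"
      then have "0 < e / 2" by simp
      with diff obtain V V' where V: "Poly_Mapping.keys V \<subseteq> UNIV \<times> \<rat>" "total_norm (U - V) < e / 2"
        "Poly_Mapping.keys V' \<subseteq> UNIV \<times> \<rat>" "total_norm (W - V') < e / 2" by metis
      have "total_norm ((U - W) - (V - V')) < e"
        using total.diff_le [of "U - V" "W - V'"] V by (simp add: algebra_simps)
      moreover have "Poly_Mapping.keys (V - V') \<subseteq> UNIV \<times> \<rat>"
        using keys_diff [of V V'] V by blast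
      ultimately show "\<exists>V. Poly_Mapping.keys V \<subseteq> UNIV \<times> \<rat> \<and> total_norm ((U - W) - V) < e" by blast
    qed
  qed
  then show ?thesis using that assms le_less_trans [OF ext_norm_le_total] by blast
qed

end

section \<open>Abstract groups and quotients by null elements\<close>

lemma group_of_abelian_group_on:
  assumes "abelian_group_on G"
  shows "comm_group \<lparr>carrier = pv_carrier G, monoid.mult = pv_add G, one = pv_zero G\<rparr>"
proof -
  have "\<exists>y\<in>pv_carrier G. pv_add G y x = pv_zero G" if "x \<in> pv_carrier G" for x
    using assms that unfolding abelian_group_on_def by (intro bexI [of _ "pv_neg G x"]) metis+
  moreover have "pv_add G (pv_zero G) x = x" if "x \<in> pv_carrier G" for x
    using assms that unfolding abelian_group_on_def by metis
  ultimately show ?thesis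
    by (intro comm_groupI) (use assms in \<open>auto simp: abelian_group_on_def\<close>)
qed

lemma neg_eq_inv:
  assumes "abelian_group_on G" "x \<in> pv_carrier G"
  shows "pv_neg G x = inv\<^bsub>\<lparr>carrier = pv_carrier G, monoid.mult = pv_add G, one = pv_zero G\<rparr>\<^esub> x"
proof -
  interpret comm_group "\<lparr>carrier = pv_carrier G, monoid.mult = pv_add G, one = pv_zero G\<rparr>"
    by (rule group_of_abelian_group_on) fact
  show ?thesis
    by (rule inv_equality [symmetric]) (use assms in \<open>auto simp: abelian_group_on_def\<close>)
qed

lemma additive_map_zero:
  assumes G: "abelian_group_on G" and H: "abelian_group_on H"
    and f: "f ` pv_carrier G \<subseteq> pv_carrier H"
      "\<And>x y. \<lbrakk>x \<in> pv_carrier G; y \<in> pv_carrier G\<rbrakk> \<Longrightarrow> f (pv_add G x y) = pv_add H (f x) (f y)"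
  shows "f (pv_zero G) = pv_zero H"
proof -
  interpret H: comm_group "\<lparr>carrier = pv_carrier H, monoid.mult = pv_add H, one = pv_zero H\<rparr>"
    by (rule group_of_abelian_group_on) fact
  have z: "pv_zero G \<in> pv_carrier G" "pv_add G (pv_zero G) (pv_zero G) = pv_zero G"
    using G by (auto simp: abelian_group_on_def)
  then have "pv_add H (f (pv_zero G)) (f (pv_zero G)) = f (pv_zero G)" using f(2) by metis
  then show ?thesis using H.r_cancel_one [of "f (pv_zero G)" "f (pv_zero G)"] z f(1) by auto
qed

lemma nmul_closed:
  assumes "abelian_group_on G" "x \<in> pv_carrier G"
  shows "pv_nmul G n x \<in> pv_carrier G"
  unfolding pv_nmul_def using assms by (induction n) (auto simp: abelian_group_on_def)

lemma nmul_Suc: "pv_nmul G (Suc n) x = pv_add G x (pv_nmul G n x)"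
  by (simp add: pv_nmul_def)

lemma nmul_0 [simp]: "pv_nmul G 0 x = pv_zero G"
  by (simp add: pv_nmul_def)

lemma additive_map_nmul:
  assumes G: "abelian_group_on G" and H: "abelian_group_on H"
    and f: "f ` pv_carrier G \<subseteq> pv_carrier H"
      "\<And>x y. \<lbrakk>x \<in> pv_carrier G; y \<in> pv_carrier G\<rbrakk> \<Longrightarrow> f (pv_add G x y) = pv_add H (f x) (f y)"
    and x: "x \<in> pv_carrier G"
  shows "f (pv_nmul G n x) = pv_nmul H n (f x)"
  by (induction n) (simp_all add: nmul_Suc f nmul_closed G x additive_map_zero [OF G H f])

definition repr :: "('k \<Rightarrow> 'c) \<Rightarrow> 'c \<Rightarrow> 'k" where
  "repr j u = (SOME x. j x = u)"

lemma repr_eq [simp]: "j (repr j (j x)) = j x"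
  unfolding repr_def by (rule someI [of _ x]) simp

text \<open>The quotient by null elements, with classes coded as values of \<open>j\<close> in an
  arbitrary type. The map \<open>j\<close> is meant to identify exactly the elements at
  \<open>Q\<close>-distance 0, and \<open>repr\<close> picks some preimage.\<close>

definition quot_pvg :: "('k::ab_group_add \<Rightarrow> real) \<Rightarrow> (real \<Rightarrow> 'k \<Rightarrow> 'k) \<Rightarrow> ('k \<Rightarrow> 'c) \<Rightarrow> 'c pvg" where
  "quot_pvg Q \<sigma> j = \<lparr>pv_carrier = range j, pv_add = (\<lambda>u v. j (repr j u + repr j v)),
     pv_neg = (\<lambda>u. j (- repr j u)), pv_zero = j 0, pv_act = (\<lambda>t u. j (\<sigma> t (repr j u))),
     pv_norm = (\<lambda>u. Q (repr j u))\<rparr>"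

lemma (in pseudo_pvg) pseudo_pvg_min: "pseudo_pvg (\<lambda>x. min (Q x) 1) \<sigma>"
proof -
  interpret min: pseudonorm "\<lambda>x. min (Q x) 1"
    by (rule pseudonorm_min) (simp_all add: pseudonorm_axioms)
  have le: "min q 1 \<le> max t 1 * min r 1" if "q \<le> max t 1 * r" for q r t :: real
    using that mult_mono [of 1 "max t 1" 1 1] by (auto simp: min_def)
  show ?thesis
    by unfold_locales (auto simp: act_add act_null act_one act_mult intro: le act_le)
qed

text \<open>Elements at distance 0 have the same null class, so Hilbert choice picks the same
  representative for them; the injection then moves representatives into the target type.\<close>

lemma (in pseudonorm) quotient_map:
  fixes \<iota> :: "'k \<Rightarrow> 'c"
  assumes "inj \<iota>"
  obtains j :: "'k \<Rightarrow> 'c" where "\<And>x y. j x = j y \<longleftrightarrow> Q (x - y) = 0"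
proof
  fix x y
  define r where "r x = (SOME y. Q (x - y) = 0)" for x
  have r: "Q (x - r x) = 0" for x
    unfolding r_def by (rule someI [of _ x]) simp
  have "r x = r y" if "Q (x - y) = 0" for x y
  proof -
    have "Q (x - z) = 0 \<longleftrightarrow> Q (y - z) = 0" for z
      using eq_of_diff_zero [of "x - z" "y - z"] that by simp
    then show ?thesis by (simp add: r_def)
  qed
  moreover have "Q (x - y) = 0" if "r x = r y"
    using dist_triangle [of x y "r x"] r [of x] r [of y] commute [of "r x" y] that
    by (simp add: order_antisym)
  ultimately show "(\<iota> \<circ> r) x = (\<iota> \<circ> r) y \<longleftrightarrow> Q (x - y) = 0"
    using inj_eq [OF assms] by auto
qed

locale pvg_quotient = pseudo_pvg Q \<sigma> for Q :: "'k::ab_group_add \<Rightarrow> real" and \<sigma> +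
  fixes j :: "'k \<Rightarrow> 'c"
  assumes j_eq: "j x = j y \<longleftrightarrow> Q (x - y) = 0"
begin

abbreviation H :: "'c pvg" where "H \<equiv> quot_pvg Q \<sigma> j"

lemma rep: "Q (repr j (j x) - x) = 0"
  by (simp add: j_eq [symmetric])

lemma carrier_H [simp]: "pv_carrier H = range j"
  by (simp add: quot_pvg_def)

lemma zero_H: "pv_zero H = j 0"
  by (simp add: quot_pvg_def)

lemma add_H: "pv_add H (j x) (j y) = j (x + y)"
proof -
  have "repr j (j x) + repr j (j y) - (x + y) = (repr j (j x) - x) + (repr j (j y) - y)" by simp
  then have "Q (repr j (j x) + repr j (j y) - (x + y)) = 0"
    using triangle [of "repr j (j x) - x" "repr j (j y) - y"] rep [of x] rep [of y] nonneg
    by (simp only:) (simp add: order_antisym)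
  then show ?thesis by (simp add: quot_pvg_def j_eq)
qed

lemma neg_H: "pv_neg H (j x) = j (- x)"
proof -
  have "Q (- repr j (j x) - - x) = 0"
    using rep [of x] commute [of x "repr j (j x)"] by simp
  then show ?thesis by (simp add: quot_pvg_def j_eq)
qed

lemma act_H: "0 \<le> t \<Longrightarrow> pv_act H t (j x) = j (\<sigma> t x)"
  using act_dist_le [of t "repr j (j x)" x] rep [of x] by (simp add: quot_pvg_def j_eq order_antisym)

lemma norm_H: "pv_norm H (j x) = Q x"
  using eq_of_diff_zero [OF rep] by (simp add: quot_pvg_def)

lemma dist_H: "pv_dist H (j x) (j y) = Q (x - y)"
  by (simp add: pv_dist_def neg_H add_H norm_H)

lemma abelian_group_on_H: "abelian_group_on H"
  by (auto simp: abelian_group_on_def zero_H add_H neg_H algebra_simps)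

lemma pseudovector_group_H: "pseudovector_group H"
  unfolding pseudovector_group_def carrier_H
proof (intro conjI allI impI ballI)
  show "abelian_group_on H" by (rule abelian_group_on_H)
  show "pv_act H 0 u = pv_zero H" if "u \<in> range j" for u
    using that by (auto simp: act_H zero_H j_eq act_null)
  show "pv_act H 1 u = u" if "u \<in> range j" for u
    using that by (auto simp: act_H j_eq act_one)
  fix t :: real assume "0 \<le> t"
  show "pv_act H t u \<in> range j" if "u \<in> range j" for u
    using that \<open>0 \<le> t\<close> by (auto simp: act_H)
  show "pv_act H t (pv_add H u v) = pv_add H (pv_act H t u) (pv_act H t v)"
    if "u \<in> range j" "v \<in> range j" for u v
    using that \<open>0 \<le> t\<close> by (auto simp: act_H add_H act_add)
  show "pv_act H (t * s) u = pv_act H t (pv_act H s u)" if "0 \<le> s" "u \<in> range j" for s u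
    using that \<open>0 \<le> t\<close> by (auto simp: act_H j_eq act_mult)
qed

lemma is_value_H: "is_value H"
  unfolding is_value_def carrier_H
proof (intro conjI ballI)
  fix u v assume "u \<in> range j" "v \<in> range j"
  then obtain x y where uv: "u = j x" "v = j y" by auto
  show "0 \<le> pv_norm H u" "pv_norm H u = 0 \<longleftrightarrow> u = pv_zero H" "pv_norm H (pv_neg H u) = pv_norm H u"
    "pv_norm H (pv_add H u v) \<le> pv_norm H u + pv_norm H v"
    by (simp_all add: uv zero_H neg_H add_H norm_H j_eq triangle)
qed

lemma subnormed_H: "subnormed_pvg H"
  unfolding subnormed_pvg_def carrier_H
proof (intro conjI allI impI ballI pseudovector_group_H is_value_H)
  fix t :: real and u assume "0 \<le> t" "u \<in> range j"
  then obtain x where "u = j x" by blast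
  show "pv_norm H (pv_act H t u) \<le> max t 1 * pv_norm H u"
    unfolding \<open>u = j x\<close> act_H [OF \<open>0 \<le> t\<close>] norm_H by (rule act_le) fact
qed

lemma nmul_H: "pv_nmul H n (j x) = j (((+) x ^^ n) 0)"
  by (induction n) (simp_all add: nmul_Suc zero_H add_H)

lemma dense_H:
  assumes "D \<subseteq> range j" "\<And>x e. 0 < e \<Longrightarrow> \<exists>y. j y \<in> D \<and> Q (x - y) < e"
  shows "pv_dense_in H D"
  unfolding pv_dense_in_def
proof (intro conjI ballI allI impI)
  fix u and e :: real assume "u \<in> pv_carrier H" "0 < e"
  then obtain x where "u = j x" by auto
  moreover obtain y where "j y \<in> D" "Q (x - y) < e" using assms(2) \<open>0 < e\<close> by blast
  ultimately show "\<exists>d\<in>D. pv_dist H u d < e" by (intro bexI [of _ "j y"]) (simp_all add: dist_H)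
qed (use assms(1) in auto)

text \<open>\<open>U\<close> is a subgroup stable under the action and containing \<open>x\<close>,
  so its image covers the span of \<open>j x\<close>; a bound \<open>B\<close> for \<open>Q\<close>
  on \<open>U\<close> bounds the diameter of the span by \<open>2 * B\<close>.\<close>

lemma E_H_I:
  assumes order: "1 \<le> n" "Q (((+) x ^^ n) 0) = 0"
    and lip: "\<And>s t. \<lbrakk>0 \<le> s; 0 \<le> t\<rbrakk> \<Longrightarrow> Q (\<sigma> s x - \<sigma> t x) \<le> C * \<bar>s - t\<bar>"
    and U: "x \<in> U" "0 \<in> U" "\<And>y z. \<lbrakk>y \<in> U; z \<in> U\<rbrakk> \<Longrightarrow> y + z \<in> U" "\<And>y. y \<in> U \<Longrightarrow> - y \<in> U"
      "\<And>t y. \<lbrakk>0 \<le> t; y \<in> U\<rbrakk> \<Longrightarrow> \<sigma> t y \<in> U" "\<And>y. y \<in> U \<Longrightarrow> Q y \<le> B"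
  shows "j x \<in> pv_E H"
proof -
  have "pv_finite_order H (j x)"
    unfolding pv_finite_order_def using order by (intro exI [of _ n]) (simp add: nmul_H zero_H j_eq)
  moreover have "pv_lipschitz_elem H (j x)"
    unfolding pv_lipschitz_elem_def using lip by (intro exI [of _ C]) (simp add: act_H dist_H)
  moreover have lin: "\<exists>u\<in>U. v = j u" if "v \<in> pv_lin H {j x}" for v
  proof -
    have "\<exists>u\<in>U. foldr (pv_add H) (map (\<lambda>(t, a). pv_act H t a) xs) (pv_zero H) = j u"
      if "\<forall>(t, a)\<in>set xs. 0 \<le> t \<and> a \<in> {j x} \<union> pv_neg H ` {j x} \<union> {pv_zero H}" for xs
      using that
    proof (induction xs)
      case Nil
      show ?case using U by (auto simp: zero_H)
    next
      case (Cons k xs)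
      obtain t a where k: "k = (t, a)" by (cases k)
      from Cons obtain u where "u \<in> U"
        "foldr (pv_add H) (map (\<lambda>(t, a). pv_act H t a) xs) (pv_zero H) = j u" by auto
      moreover have "0 \<le> t" "a = j x \<or> a = j (- x) \<or> a = j 0"
        using Cons.prems by (auto simp: k zero_H neg_H)
      then obtain y where "y \<in> U" "a = j y" using U by blast
      ultimately show ?case
        using \<open>0 \<le> t\<close> U by (intro bexI [of _ "\<sigma> t y + u"]) (auto simp: k act_H add_H)
    qed
    then show ?thesis using that unfolding pv_lin_def by blast
  qed
  have "pv_dist H v w \<le> 2 * B" if v: "v \<in> pv_lin H {j x}" and w: "w \<in> pv_lin H {j x}" for v w
  proof -
    obtain y z where "y \<in> U" "v = j y" "z \<in> U" "w = j z" using lin [OF v] lin [OF w] by blast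
    then show ?thesis using U(6) [of y] U(6) [of z] diff_le [of y z] by (simp add: dist_H)
  qed
  then have "pv_bounded_elem H (j x)" unfolding pv_bounded_elem_def by blast
  ultimately show ?thesis by (simp add: pv_E_def)
qed

end

section \<open>Density of Lipschitz bounded elements of finite order\<close>

context pvg_extension
begin

text \<open>Finite order, Lipschitz continuity and boundedness hold for every finite combination of
  adjoined elements, not just for single ones. The hypothesis \<open>le\<close> admits both
  \<open>ext_norm\<close> and its truncation at 1.\<close>

lemma E_extension:
  assumes "pvg_quotient Q ext_act j" and le: "\<And>x. Q x \<le> ext_norm x"
  shows "j (0, W) \<in> pv_E (quot_pvg Q ext_act j)"
proof -
  interpret pvg_quotient Q ext_act j by fact
  obtain C where C: "\<And>s t. ext_norm (0, rescale s W - rescale t W) \<le> C * \<bar>s - t\<bar>"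
    using ext_norm_lipschitz by blast
  \<comment> \<open>A common multiple of the orders of the finitely many adjoined elements that
    occur.\<close>
  define n where "n = prod order (indices W)"
  show ?thesis
  proof (rule E_H_I)
    show "1 \<le> n" using order_pos by (simp add: n_def Suc_le_eq prod_pos)
    have pow: "((+) (0::'x \<Rightarrow>\<^sub>0 int, W) ^^ k) 0 = (0, frag_cmul (int k) W)" for k
      by (induction k) (simp_all add: zero_prod_def frag_cmul_distrib)
    have "total_norm (frag_cmul (int n) W) = 0"
      by (rule total_norm_cmul) (simp add: n_def dvd_prodI)
    then have "Q (0, frag_cmul (int n) W) \<le> 0"
      using le [of "(0, frag_cmul (int n) W)"] ext_norm_le_total [of "frag_cmul (int n) W"] by simp
    then show "Q (((+) (0, W) ^^ n) 0) = 0"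
      unfolding pow using nonneg by (rule order_antisym)
    show "Q (ext_act s (0, W) - ext_act t (0, W)) \<le> C * \<bar>s - t\<bar>" if "0 \<le> s" "0 \<le> t" for s t
      using order_trans [OF le C] that by (simp add: ext_act_eq pseudo_pvg.act_0)
    \<comment> \<open>Combinations of the same adjoined elements with any scalars; their caps
      \<open>M\<close> add up to a uniform bound.\<close>
    define U where "U = {(0::'x \<Rightarrow>\<^sub>0 int, V) | V. indices V \<subseteq> indices W}"
    show "(0, W) \<in> U" "0 \<in> U" by (auto simp: U_def zero_prod_def)
    show "y + z \<in> U" if "y \<in> U" "z \<in> U" for y z
      using that indices_add by (fastforce simp: U_def)
    show "- y \<in> U" if "y \<in> U" for y using that by (auto simp: U_def)
    show "ext_act t y \<in> U" if "0 \<le> t" "y \<in> U" for t y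
      using that indices_rescale by (fastforce simp: U_def ext_act_eq)
    show "Q y \<le> sum M (indices W)" if y: "y \<in> U" for y
    proof -
      obtain V where V: "y = (0, V)" "indices V \<subseteq> indices W" using y unfolding U_def by blast
      have "Q y \<le> ext_norm y" by (rule le)
      also have "\<dots> \<le> total_norm V" unfolding V by (rule ext_norm_le_total)
      also have "\<dots> \<le> sum M (indices W)" by (rule total_norm_le_M) (use V in auto)
      finally show ?thesis .
    qed
  qed
qed

text \<open>In \<open>(y, W)\<close> only \<open>y\<close> has to be replaced: it is close to some
  \<open>a i\<close>, which is within \<open>\<epsilon> i\<close> of its generator, and
  \<open>W\<close> is kept.\<close>

lemma dense_E_extension:
  assumes "pvg_quotient Q ext_act j" and le: "\<And>x. Q x \<le> ext_norm x"
    and dense: "\<And>x e. 0 < e \<Longrightarrow> \<exists>i. P (x - a i) < e \<and> \<epsilon> i < e"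
  shows "pv_dense_in (quot_pvg Q ext_act j) (pv_E (quot_pvg Q ext_act j))"
proof -
  interpret pvg_quotient Q ext_act j by fact
  show ?thesis
  proof (rule dense_H)
    show "pv_E H \<subseteq> range j" by (auto simp: pv_E_def)
    fix x :: "('x \<Rightarrow>\<^sub>0 int) \<times> ('i \<times> real \<Rightarrow>\<^sub>0 int)" and e :: real
    assume "0 < e"
    obtain y W where x: "x = (y, W)" by (cases x)
    obtain i where i: "P (y - a i) < e / 2" "\<epsilon> i < e / 2"
      using dense [of "e / 2" y] \<open>0 < e\<close> by auto
    have "x - (0, frag_of (i, 1) + W) = (y - a i, 0) + (a i, - frag_of (i, 1))" by (simp add: x)
    then have "Q (x - (0, frag_of (i, 1) + W)) \<le> ext_norm (y - a i, 0) + ext_norm (a i, - frag_of (i, 1))"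
      by (simp only:) (rule order_trans [OF le ext.triangle])
    also have "\<dots> < e"
      using i ext_norm_gen_le [of i] by (simp add: ext_norm_eq)
    finally show "\<exists>y. j y \<in> pv_E H \<and> Q (x - y) < e"
      using E_extension [OF assms(1) le] by blast
  qed
qed

text \<open>Points of \<open>D\<close> paired with combinations that have rational scalars form a
  countable dense set, as the index type is countable.\<close>

lemma separable_extension:
  assumes "pvg_quotient Q ext_act j" and le: "\<And>x. Q x \<le> ext_norm x"
    and D: "countable D" "\<And>x e. 0 < e \<Longrightarrow> \<exists>d\<in>D. P (x - d) < e"
    and "countable (UNIV :: 'i set)"
  shows "pv_separable (quot_pvg Q ext_act j)"
proof -
  interpret pvg_quotient Q ext_act j by fact
  define R where "R = {V :: 'i \<times> real \<Rightarrow>\<^sub>0 int. Poly_Mapping.keys V \<subseteq> UNIV \<times> \<rat>}"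
  have "infinite ((UNIV :: 'i set) \<times> (\<rat> :: real set))"
    using Rats_infinite finite_cartesian_productD2 by blast
  then have "carrier (free_Abelian_group ((UNIV :: 'i set) \<times> (\<rat> :: real set))) \<approx> (UNIV :: 'i set) \<times> (\<rat> :: real set)"
    by (rule eqpoll_free_Abelian_group_infinite)
  moreover have "carrier (free_Abelian_group ((UNIV :: 'i set) \<times> (\<rat> :: real set))) = R"
    by (auto simp: R_def)
  moreover have "countable ((UNIV :: 'i set) \<times> (\<rat> :: real set))"
    using assms(5) countable_rat by (rule countable_SIGMA)
  ultimately have "countable R"
    by (metis countable_eqpoll)
  then have "countable (j ` (D \<times> R))" using D(1) by simp
  moreover have "pv_dense_in H (j ` (D \<times> R))"
  proof (rule dense_H)
    fix x :: "('x \<Rightarrow>\<^sub>0 int) \<times> ('i \<times> real \<Rightarrow>\<^sub>0 int)" and e :: real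
    assume "0 < e"
    obtain y W where x: "x = (y, W)" by (cases x)
    obtain d where d: "d \<in> D" "P (y - d) < e / 2" using D(2) [of "e / 2" y] \<open>0 < e\<close> by auto
    obtain V where V: "V \<in> R" "ext_norm (0, W - V) < e / 2"
      using ext_norm_rational_approx [of "e / 2" W] \<open>0 < e\<close> by (auto simp: R_def)
    have "x - (d, V) = (y - d, 0) + (0, W - V)" by (simp add: x)
    then have "Q (x - (d, V)) \<le> ext_norm (y - d, 0) + ext_norm (0, W - V)"
      by (simp only:) (rule order_trans [OF le ext.triangle])
    also have "\<dots> < e" using d V by (simp add: ext_norm_eq)
    finally show "\<exists>y. j y \<in> j ` (D \<times> R) \<and> Q (x - y) < e" using d V by blast
  qed auto
  ultimately show ?thesis unfolding pv_separable_def by blast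
qed

end

section \<open>Free presentations\<close>

text \<open>Replacing the carrier set by a free Abelian group makes type class algebra available; the
  norm becomes a pseudonorm there.\<close>

lemma free_presentation:
  fixes G :: "'a pvg"
  assumes "abelian_group_on G"
  obtains h :: "('a \<Rightarrow>\<^sub>0 int) \<Rightarrow> 'a" where "\<And>x. h x \<in> pv_carrier G"
    "\<And>x y. h (x + y) = pv_add G (h x) (h y)" "h 0 = pv_zero G" "\<And>x. h (- x) = pv_neg G (h x)"
    "\<And>g. g \<in> pv_carrier G \<Longrightarrow> h (frag_of g) = g"
    "\<And>g. g \<notin> pv_carrier G \<Longrightarrow> h (frag_of g) = pv_zero G"
proof -
  let ?G = "\<lparr>carrier = pv_carrier G, monoid.mult = pv_add G, one = pv_zero G\<rparr>"
  interpret comm_group ?G by (rule group_of_abelian_group_on) fact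
  let ?f = "\<lambda>g. if g \<in> pv_carrier G then g else pv_zero G"
  have img: "?f ` UNIV \<subseteq> carrier ?G" using one_closed by auto
  obtain h where hom: "h \<in> hom (free_Abelian_group UNIV) ?G"
    and h: "\<And>g. g \<in> UNIV \<Longrightarrow> h (frag_of g) = ?f g"
    by (rule free_Abelian_group_universal [OF img]) (rule that)
  have closed: "h x \<in> pv_carrier G" for x
    using hom_in_carrier [OF hom, of x] by simp
  have add: "h (x + y) = pv_add G (h x) (h y)" for x y
    using hom_mult [OF hom, of x y] by simp
  have zero: "h 0 = pv_zero G"
    using add [of 0 0] r_cancel_one [of "h 0" "h 0"] closed [of 0] by simp
  have "h (- x) = pv_neg G (h x)" for x
    unfolding neg_eq_inv [OF assms closed]
    using add [of "- x" x] closed by (intro inv_equality [symmetric]) (simp_all add: zero)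
  with closed add zero h show ?thesis by (intro that [of h]) auto
qed

text \<open>Defined on generators and extended additively, hence exactly additive. Generators
  outside the carrier go to 0, in line with \<open>h_of_outside\<close>.\<close>

definition lift_act :: "'a pvg \<Rightarrow> real \<Rightarrow> ('a \<Rightarrow>\<^sub>0 int) \<Rightarrow> ('a \<Rightarrow>\<^sub>0 int)" where
  "lift_act G t = frag_extend (\<lambda>g. if g \<in> pv_carrier G then frag_of (pv_act G t g) else 0)"

locale presented_pvg =
  fixes G :: "'a pvg" and h :: "('a \<Rightarrow>\<^sub>0 int) \<Rightarrow> 'a"
  assumes subnormed: "subnormed_pvg G"
    and h_closed [simp]: "h x \<in> pv_carrier G"
    and h_add: "h (x + y) = pv_add G (h x) (h y)" and h_0: "h 0 = pv_zero G"
    and h_minus: "h (- x) = pv_neg G (h x)"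
    and h_of: "g \<in> pv_carrier G \<Longrightarrow> h (frag_of g) = g"
    and h_of_outside: "g \<notin> pv_carrier G \<Longrightarrow> h (frag_of g) = pv_zero G"
begin

lemma abelian: "abelian_group_on G" and pseudovector: "pseudovector_group G" and val: "is_value G"
  using subnormed by (auto simp: subnormed_pvg_def pseudovector_group_def)

definition P :: "('a \<Rightarrow>\<^sub>0 int) \<Rightarrow> real" where
  "P x = pv_norm G (h x)"

lemma h_diff: "h (x - y) = pv_add G (h x) (pv_neg G (h y))"
  using h_add [of x "- y"] by (simp add: h_minus)

lemma P_diff: "P (x - y) = pv_dist G (h x) (h y)"
  by (simp add: P_def h_diff pv_dist_def)

lemma P_diff_eq_0: "P (x - y) = 0 \<longleftrightarrow> h x = h y"
proof
  assume "P (x - y) = 0"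
  then have "h (x - y) = pv_zero G" using val unfolding P_def is_value_def by simp
  then have "h x = pv_add G (pv_zero G) (h y)" using h_add [of "x - y" y] by simp
  then show "h x = h y" using h_add [of 0 y] by (simp add: h_0)
next
  assume "h x = h y"
  then have "h (x - y) = h (y - y)" by (simp only: h_diff)
  then show "P (x - y) = 0" using val h_closed [of 0] unfolding P_def is_value_def by (simp add: h_0)
qed

lemma h_act:
  assumes "0 \<le> t"
  shows "h (lift_act G t x) = pv_act G t (h x)"
proof -
  have closed: "pv_act G t g \<in> pv_carrier G" if "g \<in> pv_carrier G" for g
    using pseudovector assms that by (simp add: pseudovector_group_def)
  have add: "pv_act G t (h (x + y)) = pv_add G (pv_act G t (h x)) (pv_act G t (h y))" for x y
    using pseudovector assms by (simp add: pseudovector_group_def h_add)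
  have zero: "pv_act G t (pv_zero G) = pv_zero G"
    using additive_map_zero [OF abelian abelian, of "pv_act G t"] pseudovector assms
    by (auto simp: pseudovector_group_def closed)
  show ?thesis
    using subset_UNIV
  proof (induction x rule: frag_induction)
    case zero
    show ?case by (simp add: lift_act_def h_0 \<open>pv_act G t (pv_zero G) = pv_zero G\<close>)
  next
    case (one g)
    then show ?case by (cases "g \<in> pv_carrier G") (simp_all add: lift_act_def h_of closed h_of_outside h_0 zero)
  next
    case (diff x y)
    \<comment> \<open>The action respects sums, so the difference is recovered by cancelling
      \<open>h (lift_act G t y)\<close> on the right.\<close>
    have 1: "pv_add G (pv_act G t (h (x - y))) (h (lift_act G t y)) = h (lift_act G t x)"
      using add [of "x - y" y] diff by simp
    interpret comm_group "\<lparr>carrier = pv_carrier G, monoid.mult = pv_add G, one = pv_zero G\<rparr>"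
      by (rule group_of_abelian_group_on) (rule abelian)
    have 2: "pv_add G (h (lift_act G t (x - y))) (h (lift_act G t y)) = h (lift_act G t x)"
      using h_add [of "lift_act G t (x - y)" "lift_act G t y"] by (simp add: lift_act_def frag_extend_diff)
    show ?case
      using right_cancel [of "h (lift_act G t y)" "h (lift_act G t (x - y))" "pv_act G t (h (x - y))"] 1 2 closed
      by simp
  qed
qed

sublocale frag_pvg P "lift_act G"
proof -
  have "pseudo_pvg P (lift_act G)"
  proof
    show "P 0 = 0" using P_diff_eq_0 [of 0 0] by simp
    show "P (- x) = P x" for x using val by (simp add: P_def h_minus is_value_def)
    show "P (x + y) \<le> P x + P y" for x y using val by (simp add: P_def h_add is_value_def)
    show "lift_act G t (x + y) = lift_act G t x + lift_act G t y" for t x y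
      by (simp add: lift_act_def frag_extend_add)
    have zero: "P x = 0 \<longleftrightarrow> h x = pv_zero G" for x
      using P_diff_eq_0 [of x 0] by (simp add: h_0)
    show "P (lift_act G 0 x) = 0" for x
      using pseudovector by (simp add: zero h_act pseudovector_group_def)
    show "P (lift_act G 1 x - x) = 0" for x
      using pseudovector by (simp add: P_diff_eq_0 h_act pseudovector_group_def)
    show "P (lift_act G (s * t) x - lift_act G s (lift_act G t x)) = 0" if "0 \<le> s" "0 \<le> t" for s t x
      using pseudovector that by (simp add: P_diff_eq_0 h_act pseudovector_group_def)
    show "P (lift_act G t x) \<le> max t 1 * P x" if "0 \<le> t" for t x
      using subnormed that by (simp add: P_def h_act subnormed_pvg_def)
  qed
  then show "frag_pvg P (lift_act G)" by (rule frag_pvg.intro)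
qed

lemma h_cmul: "h (frag_cmul (int n) x) = pv_nmul G n (h x)"
  by (induction n) (simp_all add: frag_cmul_distrib h_add h_0 nmul_Suc)

end

lemma presented_pvg_exists:
  fixes G :: "'a pvg"
  assumes "subnormed_pvg G"
  obtains h where "presented_pvg G h"
proof -
  have "abelian_group_on G" using assms by (simp add: subnormed_pvg_def pseudovector_group_def)
  then obtain h where "presented_pvg G h"
    using free_presentation [of G] assms unfolding presented_pvg_def by metis
  then show ?thesis by (rule that)
qed

section \<open>Classes of pseudovector groups\<close>

text \<open>Lets growth rates pass from \<open>d\<close> to nearby \<open>x\<close>: scaling by
  \<open>t\<close> stretches distances by at most \<open>max t 1\<close>, taking the
  \<open>n\<close>-th multiple by at most \<open>n\<close>.\<close>

lemma pv_act_dist_le: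
  fixes H :: "'a pvg"
  assumes "subnormed_pvg H" "x \<in> pv_carrier H" "d \<in> pv_carrier H" "0 \<le> t"
  shows "pv_norm H (pv_act H t x) \<le> pv_norm H (pv_act H t d) + max t 1 * pv_dist H x d"
    and "pv_norm H (pv_nmul H n x) \<le> pv_norm H (pv_nmul H n d) + real n * pv_dist H x d"
proof -
  obtain h where "presented_pvg H h" using presented_pvg_exists [OF assms(1)] .
  then interpret presented_pvg H h .
  let ?x = "frag_of x" and ?d = "frag_of d"
  have hx: "h ?x = x" "h ?d = d" using assms by (simp_all add: h_of)
  show "pv_norm H (pv_act H t x) \<le> pv_norm H (pv_act H t d) + max t 1 * pv_dist H x d"
    using le_add_diff [of "lift_act H t ?x" "lift_act H t ?d"] act_dist_le [OF assms(4), of ?x ?d]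
    unfolding P_diff hx by (simp add: P_def h_act assms(4) hx)
  have "frag_cmul (int n) ?x - frag_cmul (int n) ?d = frag_cmul (int n) (?x - ?d)"
    by (rule poly_mapping_eqI) (simp add: lookup_minus)
  then have "P (frag_cmul (int n) ?x - frag_cmul (int n) ?d) \<le> real n * P (?x - ?d)"
    using frag_cmul_le [of "int n" "?x - ?d"] by simp
  then show "pv_norm H (pv_nmul H n x) \<le> pv_norm H (pv_nmul H n d) + real n * pv_dist H x d"
    using le_add_diff [of "frag_cmul (int n) ?x" "frag_cmul (int n) ?d"]
    unfolding P_diff hx by (simp add: P_def h_cmul hx)
qed

text \<open>All \<open>t * d\<close> and all multiples of \<open>d\<close>, as well as 0, lie in the
  span of \<open>d\<close>, so the diameter of the span bounds their norms.\<close>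

lemma pv_E_bounded:
  fixes H :: "'a pvg"
  assumes H: "subnormed_pvg H" and d: "d \<in> pv_E H"
  shows "\<exists>B. (\<forall>t\<ge>0. pv_norm H (pv_act H t d) \<le> B) \<and> (\<forall>n. pv_norm H (pv_nmul H n d) \<le> B)"
proof -
  obtain h where "presented_pvg H h" using presented_pvg_exists [OF H] .
  then interpret presented_pvg H h .
  have dc: "d \<in> pv_carrier H" using d by (simp add: pv_E_def)
  then have hd: "h (frag_of d) = d" by (rule h_of)
  obtain B where B: "\<And>x y. \<lbrakk>x \<in> pv_lin H {d}; y \<in> pv_lin H {d}\<rbrakk> \<Longrightarrow> pv_dist H x y \<le> B"
    using d by (auto simp: pv_E_def pv_bounded_elem_def)
  have act: "pv_act H 1 d = d" "pv_act H 0 d = pv_zero H"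
    using pseudovector dc by (auto simp: pseudovector_group_def)
  have add0: "pv_add H x (pv_zero H) = x" if "x \<in> pv_carrier H" for x
    using abelian that by (simp add: abelian_group_on_def)
  have linI: "foldr (pv_add H) (map (\<lambda>(t, a). pv_act H t a) xs) (pv_zero H) \<in> pv_lin H {d}"
    if "xs \<noteq> []" "\<forall>(t, a)\<in>set xs. 0 \<le> t \<and> a = d" for xs
    using that unfolding pv_lin_def by (intro CollectI exI [of _ xs]) auto
  have act_lin: "pv_act H t d \<in> pv_lin H {d}" if "0 \<le> t" for t
    using linI [of "[(t, d)]"] that pseudovector dc by (simp add: add0 pseudovector_group_def)
  have "foldr (pv_add H) (map (\<lambda>(t, a). pv_act H t a) (replicate n (1, d))) (pv_zero H) = pv_nmul H n d" for n
    by (induction n) (simp_all add: act nmul_Suc)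
  \<comment> \<open>Spans are built from nonempty lists, so \<open>n = 0\<close> is covered by
    \<open>0 * d\<close>.\<close>
  then have nmul_lin: "pv_nmul H n d \<in> pv_lin H {d}" for n
    using linI [of "replicate n (1, d)"] act_lin [of 0] by (cases "n = 0") (auto simp: act)
  have norm: "pv_norm H x \<le> B" if "x \<in> pv_lin H {d}" "x = h y" for x y
    using B [OF that(1) act_lin [of 0]] P_diff [of y 0] by (simp add: act that(2) h_0 P_def)
  show ?thesis
  proof (intro exI [of _ B] conjI allI impI)
    show "pv_norm H (pv_act H t d) \<le> B" if "0 \<le> t" for t
      using norm [OF act_lin [OF that], of "lift_act H t (frag_of d)"] h_act [OF that, of "frag_of d"]
      by (simp add: hd)
    show "pv_norm H (pv_nmul H n d) \<le> B" for n
      using norm [OF nmul_lin, of n "frag_cmul (int n) (frag_of d)"] h_cmul [of n "frag_of d"] by (simp add: hd)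
  qed
qed

lemma tendsto_0_of_affine_bounds:
  fixes f :: "'t \<Rightarrow> real" and \<tau> :: "'t \<Rightarrow> real"
  assumes "filterlim \<tau> at_top F" "\<forall>\<^sub>F t in F. 0 \<le> f t"
    and bound: "\<And>e. 0 < e \<Longrightarrow> \<exists>B. \<forall>\<^sub>F t in F. f t \<le> B + e * \<tau> t"
  shows "((\<lambda>t. f t / \<tau> t) \<longlongrightarrow> 0) F"
proof (rule tendstoI)
  fix e :: real assume "0 < e"
  obtain B where B: "\<forall>\<^sub>F t in F. f t \<le> B + e / 2 * \<tau> t" using bound [of "e / 2"] \<open>0 < e\<close> by auto
  \<comment> \<open>Past this threshold the constant \<open>B\<close> is less than
    \<open>e / 2 * \<tau> t\<close>.\<close>
  have "\<forall>\<^sub>F t in F. max 1 (2 * \<bar>B\<bar> / e + 1) \<le> \<tau> t"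
    using assms(1) unfolding filterlim_at_top by blast
  then show "\<forall>\<^sub>F t in F. dist (f t / \<tau> t) 0 < e"
    using B assms(2)
  proof eventually_elim
    case (elim t)
    then have "2 * \<bar>B\<bar> / e < \<tau> t" "0 < \<tau> t" by auto
    then have "2 * \<bar>B\<bar> < e * \<tau> t" using \<open>0 < e\<close> by (simp add: field_simps)
    then have "f t < e * \<tau> t" using elim by linarith
    then show ?case using \<open>0 < \<tau> t\<close> elim by (simp add: dist_real_def field_simps)
  qed
qed

text \<open>A point within \<open>e\<close> of an element with bounded orbits grows at rate at most
  \<open>e\<close>, and \<open>e\<close> is arbitrary.\<close>

lemma class_O00_if_dense:
  fixes H :: "'a pvg"
  assumes H: "subnormed_pvg H" and dense: "pv_dense_in H (pv_E H)"
  shows "class_O00 H"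
  unfolding class_O00_def
proof (intro ballI conjI)
  fix g assume g: "g \<in> pv_carrier H"
  have nonneg: "0 \<le> pv_norm H x" if "x \<in> pv_carrier H" for x
    using H that by (simp add: subnormed_pvg_def is_value_def)
  have approx: "\<exists>B. (\<forall>t\<ge>0. pv_norm H (pv_act H t g) \<le> B + max t 1 * e)
      \<and> (\<forall>n. pv_norm H (pv_nmul H n g) \<le> B + real n * e)" if "0 < e" for e
  proof -
    obtain d where d: "d \<in> pv_E H" "pv_dist H g d < e"
      using dense g \<open>0 < e\<close> unfolding pv_dense_in_def by blast
    obtain B where B: "\<And>t. 0 \<le> t \<Longrightarrow> pv_norm H (pv_act H t d) \<le> B" "\<And>n. pv_norm H (pv_nmul H n d) \<le> B"
      using pv_E_bounded [OF H d(1)] by blast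
    have dc: "d \<in> pv_carrier H" using d by (simp add: pv_E_def)
    have "pv_norm H (pv_act H t g) \<le> B + max t 1 * e" if "0 \<le> t" for t
    proof -
      have "max t 1 * pv_dist H g d \<le> max t 1 * e" using d(2) by (intro mult_left_mono) auto
      then show ?thesis using pv_act_dist_le(1) [OF H g dc that] B(1) [OF that] by linarith
    qed
    moreover have "pv_norm H (pv_nmul H n g) \<le> B + real n * e" for n
    proof -
      have "real n * pv_dist H g d \<le> real n * e" using d(2) by (intro mult_left_mono) auto
      then show ?thesis using pv_act_dist_le(2) [OF H g dc order_refl, of n] B(2) [of n] by linarith
    qed
    ultimately show ?thesis by blast
  qed
  have ab: "abelian_group_on H" and act: "\<And>t. 0 \<le> t \<Longrightarrow> pv_act H t g \<in> pv_carrier H"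
    using H g by (simp_all add: subnormed_pvg_def pseudovector_group_def)
  show "((\<lambda>t. pv_norm H (pv_act H t g) / t) \<longlongrightarrow> 0) at_top"
  proof (rule tendsto_0_of_affine_bounds)
    show "\<forall>\<^sub>F t in at_top. 0 \<le> pv_norm H (pv_act H t g)"
      using eventually_ge_at_top [of 0] by eventually_elim (intro nonneg act)
    fix e :: real assume "0 < e"
    then obtain B where B: "\<forall>t\<ge>0. pv_norm H (pv_act H t g) \<le> B + max t 1 * e" using approx by blast
    have "\<forall>\<^sub>F t in at_top. pv_norm H (pv_act H t g) \<le> B + e * t"
      using eventually_ge_at_top [of 1]
    proof eventually_elim
      case (elim t)
      then show ?case using B [rule_format, of t] by (simp add: mult.commute)
    qed
    then show "\<exists>B. \<forall>\<^sub>F t in at_top. pv_norm H (pv_act H t g) \<le> B + e * t" by blast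
  qed (rule filterlim_ident)
  show "(\<lambda>n. pv_norm H (pv_nmul H n g) / real n) \<longlonglongrightarrow> 0"
  proof (rule tendsto_0_of_affine_bounds)
    show "\<forall>\<^sub>F n in sequentially. 0 \<le> pv_norm H (pv_nmul H n g)"
      by (intro always_eventually allI nonneg nmul_closed ab g)
    fix e :: real assume "0 < e"
    then obtain B where "\<forall>n. pv_norm H (pv_nmul H n g) \<le> B + real n * e" using approx by blast
    then show "\<exists>B. \<forall>\<^sub>F n in sequentially. pv_norm H (pv_nmul H n g) \<le> B + e * real n"
      by (intro exI [of _ B] always_eventually) (simp add: mult.commute)
  qed (rule filterlim_real_sequentially)
qed

lemma class_O00_enlarging:
  assumes G: "subnormed_pvg G" and H: "subnormed_pvg H" "pv_enlarging G H f" "class_O00 H"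
  shows "class_O00 G"
  unfolding class_O00_def
proof (intro ballI conjI)
  fix g assume g: "g \<in> pv_carrier G"
  have ab: "abelian_group_on G" "abelian_group_on H"
    and act: "\<And>t. 0 \<le> t \<Longrightarrow> pv_act G t g \<in> pv_carrier G"
    using G H g by (simp_all add: subnormed_pvg_def pseudovector_group_def)
  have f: "f ` pv_carrier G \<subseteq> pv_carrier H"
    "\<And>x y. \<lbrakk>x \<in> pv_carrier G; y \<in> pv_carrier G\<rbrakk> \<Longrightarrow> f (pv_add G x y) = pv_add H (f x) (f y)"
    "\<And>t x. \<lbrakk>0 \<le> t; x \<in> pv_carrier G\<rbrakk> \<Longrightarrow> f (pv_act G t x) = pv_act H t (f x)"
    "\<And>x. x \<in> pv_carrier G \<Longrightarrow> pv_norm H (f x) = pv_norm G x"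
    using H(2) by (auto simp: pv_enlarging_def)
  have fg: "f g \<in> pv_carrier H" using f(1) g by blast
  have "((\<lambda>t. pv_norm H (pv_act H t (f g)) / t) \<longlongrightarrow> 0) at_top"
    using H(3) fg by (simp add: class_O00_def)
  moreover have "\<forall>\<^sub>F t in at_top. pv_norm H (pv_act H t (f g)) / t = pv_norm G (pv_act G t g) / t"
    using eventually_ge_at_top [of 0]
  proof eventually_elim
    case (elim t)
    then show ?case using f(3) [OF elim g] f(4) [OF act [OF elim]] by simp
  qed
  ultimately show "((\<lambda>t. pv_norm G (pv_act G t g) / t) \<longlongrightarrow> 0) at_top"
    by (rule Lim_transform_eventually)
  have "pv_norm H (pv_nmul H n (f g)) = pv_norm G (pv_nmul G n g)" for n
    using additive_map_nmul [OF ab f(1,2) g, of n] f(4) [OF nmul_closed [OF ab(1) g], of n] by simp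
  moreover have "(\<lambda>n. pv_norm H (pv_nmul H n (f g)) / real n) \<longlonglongrightarrow> 0"
    using H(3) fg by (simp add: class_O00_def)
  ultimately show "(\<lambda>n. pv_norm G (pv_nmul G n g) / real n) \<longlonglongrightarrow> 0" by simp
qed

section \<open>The enlargement\<close>

lemma infinite_times_self_lepoll:
  assumes "infinite A" "B \<lesssim> A" "C \<lesssim> A"
  shows "B \<times> C \<lesssim> A"
proof -
  have "B \<times> C \<lesssim> A \<times> A" using assms by (intro times_lepoll_mono)
  also have "A \<times> A \<lesssim> A"
    using card_of_Times_same_infinite [OF assms(1)]
    by (simp add: lepoll_def card_of_ordLeq ordIso_imp_ordLeq)
  finally show ?thesis .
qed

text \<open>Provides room for the quotient in \<open>'a \<times> real\<close>. The factor
  \<open>real\<close> makes this type infinite even if \<open>'a\<close> is finite, and a free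
  Abelian group on an infinite set has the cardinality of that set.\<close>

lemma inj_free_pair:
  assumes "(UNIV :: 'i set) \<lesssim> (UNIV :: ('a \<times> real) set)"
  obtains \<iota> :: "('a \<Rightarrow>\<^sub>0 int) \<times> ('i \<times> real \<Rightarrow>\<^sub>0 int) \<Rightarrow> 'a \<times> real" where "inj \<iota>"
proof -
  let ?A = "UNIV :: ('a \<times> real) set"
  have real_inf: "infinite (UNIV :: real set)" by (rule infinite_UNIV_char_0)
  have inf: "infinite ?A"
    using real_inf by (simp add: finite_prod)
  have "inj (frag_extend (\<lambda>x. frag_of (x, 0 :: real)) :: ('a \<Rightarrow>\<^sub>0 int) \<Rightarrow> _)"
  proof (rule injI)
    fix c d :: "'a \<Rightarrow>\<^sub>0 int"
    have lookup: "Poly_Mapping.lookup (frag_extend (\<lambda>x. frag_of (x, 0 :: real)) c) (x, 0) = Poly_Mapping.lookup c x"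
      for c :: "'a \<Rightarrow>\<^sub>0 int" and x
      using subset_UNIV by (induction c rule: frag_induction) (auto simp: frag_extend_diff lookup_minus)
    assume "frag_extend (\<lambda>x. frag_of (x, 0 :: real)) c = frag_extend (\<lambda>x. frag_of (x, 0)) d"
    then show "c = d" using lookup [of c] lookup [of d] by (intro poly_mapping_eqI) metis
  qed
  then have "(UNIV :: ('a \<Rightarrow>\<^sub>0 int) set) \<lesssim> (UNIV :: ('a \<times> real \<Rightarrow>\<^sub>0 int) set)"
    unfolding lepoll_def by blast
  also have "(UNIV :: ('a \<times> real \<Rightarrow>\<^sub>0 int) set) \<approx> ?A"
    using eqpoll_free_Abelian_group_infinite [OF inf] by (simp add: free_Abelian_group_def)
  finally have 1: "(UNIV :: ('a \<Rightarrow>\<^sub>0 int) set) \<lesssim> ?A" .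
  have "infinite (UNIV :: ('i \<times> real) set)"
    using real_inf by (simp add: finite_prod)
  then have "(UNIV :: ('i \<times> real \<Rightarrow>\<^sub>0 int) set) \<approx> (UNIV :: ('i \<times> real) set)"
    using eqpoll_free_Abelian_group_infinite by (force simp: free_Abelian_group_def)
  also have "(UNIV :: ('i \<times> real) set) \<lesssim> ?A"
  proof -
    have "inj (\<lambda>r :: real. (undefined :: 'a, r))" by (auto intro: injI)
    then have "(UNIV :: real set) \<lesssim> ?A" unfolding lepoll_def by blast
    then show ?thesis
      using infinite_times_self_lepoll [OF inf assms] by (simp add: UNIV_Times_UNIV [symmetric] del: UNIV_Times_UNIV)
  qed
  finally have 2: "(UNIV :: ('i \<times> real \<Rightarrow>\<^sub>0 int) set) \<lesssim> ?A" .
  have "(UNIV :: (('a \<Rightarrow>\<^sub>0 int) \<times> ('i \<times> real \<Rightarrow>\<^sub>0 int)) set) \<lesssim> ?A"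
    using infinite_times_self_lepoll [OF inf 1 2] by simp
  then show ?thesis using that unfolding lepoll_def by blast
qed

lemma norm_zero_eq_0:
  assumes "is_value G" "abelian_group_on G"
  shows "pv_norm G (pv_zero G) = 0"
proof -
  have "pv_zero G \<in> pv_carrier G" using assms(2) unfolding abelian_group_on_def by (rule conjunct1)
  then show ?thesis using assms(1) unfolding is_value_def by blast
qed

text \<open>From some \<open>m\<close> on the growth ratio is below \<open>e\<close>; every positive
  multiple of \<open>Suc m\<close> exceeds \<open>m\<close>, so \<open>Suc m\<close> serves as
  \<open>n\<close>.\<close>

lemma small_multiples:
  assumes "class_O00 G" "is_value G" "abelian_group_on G" "x \<in> pv_carrier G" "0 < e"
  shows "\<exists>n>0. \<forall>k. pv_norm G (pv_nmul G (n * k) x) \<le> e * real (n * k)"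
proof -
  have "(\<lambda>n. pv_norm G (pv_nmul G n x) / real n) \<longlonglongrightarrow> 0"
    using assms(1,4) by (simp add: class_O00_def)
  then have "\<forall>\<^sub>F n in sequentially. pv_norm G (pv_nmul G n x) / real n < e"
    using \<open>0 < e\<close> by (rule order_tendstoD)
  then obtain m where m: "\<And>n. m \<le> n \<Longrightarrow> pv_norm G (pv_nmul G n x) / real n < e"
    by (auto simp: eventually_sequentially)
  have "pv_norm G (pv_nmul G (Suc m * k) x) \<le> e * real (Suc m * k)" for k
  proof (cases "k = 0")
    case True
    then show ?thesis using norm_zero_eq_0 [OF assms(2,3)] by simp
  next
    case False
    then have "Suc m * 1 \<le> Suc m * k" by (intro mult_le_mono2) simp
    then have "m \<le> Suc m * k" by simp
    from m [OF this] have "pv_norm G (pv_nmul G (Suc m * k) x) < e * real (Suc m * k)"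
      by (subst (asm) pos_divide_less_eq) (use False in \<open>simp_all only: of_nat_0_less_iff zero_less_mult_iff, simp\<close>)
    then show ?thesis by (rule less_imp_le)
  qed
  then show ?thesis by blast
qed

text \<open>Stated for any family \<open>g\<close> because the index type differs between the uses:
  \<open>'a \<times> nat\<close> in general, and pairs of naturals enumerating a countable dense set
  when separability is to be kept.\<close>

lemma enlarging_exists:
  fixes G :: "'a pvg" and g :: "'i \<Rightarrow> 'a"
  assumes G: "subnormed_top_pvg G" "class_O00 G"
    and card: "(UNIV :: 'i set) \<lesssim> (UNIV :: ('a \<times> real) set)"
    and g: "\<And>i. g i \<in> pv_carrier G" and \<epsilon>: "\<And>i. 0 < \<epsilon> i" and \<nu>: "\<And>i. 0 < \<nu> i"
    and small: "\<And>i k. pv_norm G (pv_nmul G (\<nu> i * k) (g i)) \<le> \<epsilon> i / 2 * real (\<nu> i * k)"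
    and dense: "\<forall>x\<in>pv_carrier G. \<forall>e>0. \<exists>i. pv_dist G x (g i) < e \<and> \<epsilon> i < e"
  shows "\<exists>(H :: ('a \<times> real) pvg) f. subnormed_pvg H \<and> pv_enlarging G H f \<and> pv_dense_in H (pv_E H)
    \<and> ((\<forall>x\<in>pv_carrier G. pv_norm G x \<le> 1) \<longrightarrow> (\<forall>x\<in>pv_carrier H. pv_norm H x \<le> 1))
    \<and> (\<forall>N. (\<forall>i. \<nu> i = N) \<longrightarrow> (\<forall>x\<in>pv_carrier G. pv_nmul G N x = pv_zero G) \<longrightarrow>
          (\<forall>x\<in>pv_carrier H. pv_nmul H N x = pv_zero H))
    \<and> (countable (UNIV :: 'i set) \<longrightarrow> pv_separable H)"
proof -
  have sub: "subnormed_pvg G" using G(1) by (simp add: subnormed_top_pvg_def)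
  obtain h where "presented_pvg G h" using presented_pvg_exists [OF sub] .
  then interpret presented_pvg G h .
  define a where "a i = frag_of (g i)" for i
  have ha: "h (a i) = g i" for i by (simp add: a_def h_of g)
  have cont: "\<exists>d>0. \<forall>s\<ge>0. \<bar>s - t\<bar> < d \<longrightarrow> P (lift_act G s x - lift_act G t x) < e"
    if "0 \<le> t" "0 < e" for t e x
  proof -
    have "\<forall>t\<ge>0. \<forall>x\<in>pv_carrier G. \<forall>e>0. \<exists>d>0. \<forall>s\<ge>0. \<forall>y\<in>pv_carrier G.
        \<bar>s - t\<bar> < d \<and> pv_dist G y x < d \<longrightarrow> pv_dist G (pv_act G s y) (pv_act G t x) < e"
      using G(1) unfolding subnormed_top_pvg_def by (rule conjunct2)
    from this [THEN spec, THEN mp, OF that(1), THEN bspec, OF h_closed [of x], THEN spec, THEN mp, OF that(2)]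
    obtain d where "d > 0" and d: "\<forall>s\<ge>0. \<forall>y\<in>pv_carrier G. \<bar>s - t\<bar> < d \<and> pv_dist G y (h x) < d
        \<longrightarrow> pv_dist G (pv_act G s y) (pv_act G t (h x)) < e"
      by blast
    have "pv_dist G (h x) (h x) < d" using P_diff [of x x] \<open>d > 0\<close> by simp
    then have "\<forall>s\<ge>0. \<bar>s - t\<bar> < d \<longrightarrow> P (lift_act G s x - lift_act G t x) < e"
      using d that by (simp add: P_diff h_act)
    then show ?thesis using \<open>d > 0\<close> by blast
  qed
  have slow: "((\<lambda>t. P (lift_act G t x) / t) \<longlongrightarrow> 0) at_top" for x
  proof -
    have "((\<lambda>t. pv_norm G (pv_act G t (h x)) / t) \<longlongrightarrow> 0) at_top"
      using G(2) h_closed [of x] unfolding class_O00_def by blast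
    moreover have "\<forall>\<^sub>F t in at_top. pv_norm G (pv_act G t (h x)) / t = P (lift_act G t x) / t"
      using eventually_ge_at_top [of 0] by eventually_elim (simp add: P_def h_act)
    ultimately show ?thesis by (rule Lim_transform_eventually)
  qed
  have slow_nat: "(\<lambda>n. P (frag_cmul (int n) x) / real n) \<longlonglongrightarrow> 0" for x
    using G(2) h_closed [of x] unfolding class_O00_def by (simp add: P_def h_cmul)
  have tors: "P (frag_cmul (int (\<nu> i) * k) (a i)) \<le> \<epsilon> i / 2 * \<bar>real_of_int (int (\<nu> i) * k)\<bar>" for i k
  proof -
    have *: "P (frag_cmul (int (\<nu> i * m)) (a i)) \<le> \<epsilon> i / 2 * real (\<nu> i * m)" for m
      using small [of i m] unfolding P_def h_cmul ha .
    show ?thesis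
    proof (cases "0 \<le> k")
      case True
      then show ?thesis using * [of "nat k"] by simp
    next
      case False
      then show ?thesis
        using * [of "nat (- k)"] minus [of "frag_cmul (int (\<nu> i) * k) (a i)"]
        by (simp add: abs_mult)
    qed
  qed
  have "\<exists>M L. 0 \<le> M \<and> 0 \<le> L \<and> (\<forall>V. P (orbit (a i) V)
      \<le> \<epsilon> i * frag_norm (\<lambda>t. max t 1) V + min M (L * switch_len (\<nu> i) V))" for i
    using orbit_bound [OF cont slow slow_nat \<epsilon> tors, of i] by metis
  then obtain M L where bd: "\<And>i. 0 \<le> M i" "\<And>i. 0 \<le> L i"
    "\<And>i V. P (orbit (a i) V) \<le> \<epsilon> i * frag_norm (\<lambda>t. max t 1) V + min (M i) (L i * switch_len (\<nu> i) V)"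
    by metis
  interpret pvg_extension P "lift_act G" a \<epsilon> \<nu> M L
    by unfold_locales (use \<epsilon> \<nu> bd in auto)
  \<comment> \<open>If \<open>G\<close> is bounded by 1, truncating at 1 leaves its norm unchanged;
    this decision serves both values of \<open>r\<close> without mentioning
    \<open>r\<close>.\<close>
  define bounded where "bounded \<longleftrightarrow> (\<forall>x\<in>pv_carrier G. pv_norm G x \<le> 1)"
  define Q where "Q x = (if bounded then min (ext_norm x) 1 else ext_norm x)" for x
  have Q_le: "Q x \<le> ext_norm x" for x by (simp add: Q_def)
  interpret Q: pseudo_pvg Q ext_act
    unfolding Q_def using ext.pseudo_pvg_min ext.pseudo_pvg_axioms by (cases bounded) simp_all
  have Q_P: "Q (x, 0) = P x" for x
    using h_closed [of x] by (auto simp: Q_def ext_norm_eq bounded_def P_def)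
  obtain \<iota> :: "('a \<Rightarrow>\<^sub>0 int) \<times> ('i \<times> real \<Rightarrow>\<^sub>0 int) \<Rightarrow> 'a \<times> real" where "inj \<iota>"
    using inj_free_pair [OF card] .
  then obtain j :: "('a \<Rightarrow>\<^sub>0 int) \<times> ('i \<times> real \<Rightarrow>\<^sub>0 int) \<Rightarrow> 'a \<times> real"
    where j: "\<And>x y. j x = j y \<longleftrightarrow> Q (x - y) = 0"
    using Q.quotient_map by metis
  interpret pvg_quotient Q ext_act j by unfold_locales (rule j)
  have quot: "pvg_quotient Q ext_act j" by (rule pvg_quotient_axioms)
  define f where "f x = j (frag_of x, 0)" for x
  have f_h: "f (h x) = j (x, 0)" for x
    using P_diff_eq_0 [of "frag_of (h x)" x] h_closed [of x] by (simp add: f_def j Q_P h_of)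
  show ?thesis
  proof (intro exI [of _ H] exI [of _ f] conjI impI allI)
    show "subnormed_pvg H" by (rule subnormed_H)
    have h_surj: "\<exists>y. x = h y" if "x \<in> pv_carrier G" for x using h_of [OF that] by metis
    show "pv_enlarging G H f"
      unfolding pv_enlarging_def
    proof (intro conjI ballI allI impI)
      show "f ` pv_carrier G \<subseteq> pv_carrier H" by (auto simp: f_def)
      show "inj_on f (pv_carrier G)"
      proof (rule inj_onI)
        fix x y assume "x \<in> pv_carrier G" "y \<in> pv_carrier G" "f x = f y"
        then show "x = y" using P_diff_eq_0 [of "frag_of x" "frag_of y"] by (simp add: f_def j Q_P h_of)
      qed
      fix x y assume "x \<in> pv_carrier G" "y \<in> pv_carrier G"
      then obtain u v where uv: "x = h u" "y = h v" using h_surj by blast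
      show "f (pv_add G x y) = pv_add H (f x) (f y)"
        unfolding uv h_add [symmetric] f_h add_H by simp
    next
      fix t :: real and x assume "0 \<le> t" "x \<in> pv_carrier G"
      then obtain u where u: "x = h u" using h_surj by blast
      show "f (pv_act G t x) = pv_act H t (f x)"
        unfolding u h_act [OF \<open>0 \<le> t\<close>, symmetric] f_h act_H [OF \<open>0 \<le> t\<close>]
        by (simp add: ext_act_eq rescale_def)
    next
      fix x assume "x \<in> pv_carrier G"
      then show "pv_norm H (f x) = pv_norm G x" by (simp add: f_def norm_H Q_P P_def h_of)
    qed
    show "pv_dense_in H (pv_E H)"
    proof (rule dense_E_extension [OF quot Q_le])
      show "\<exists>i. P (x - a i) < e \<and> \<epsilon> i < e" if "0 < e" for x e
        using dense [rule_format, OF h_closed that, of x] by (simp add: P_diff ha)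
    qed
    show "\<forall>x\<in>pv_carrier H. pv_norm H x \<le> 1" if "\<forall>x\<in>pv_carrier G. pv_norm G x \<le> 1"
      using that by (auto simp: norm_H Q_def bounded_def)
    show "\<forall>x\<in>pv_carrier H. pv_nmul H N x = pv_zero H"
      if N: "\<forall>i. \<nu> i = N" "\<forall>x\<in>pv_carrier G. pv_nmul G N x = pv_zero G" for N
    proof
      fix u assume "u \<in> pv_carrier H"
      then obtain x W where u: "u = j (x, W)" by auto
      have pow: "((+) (x, W) ^^ k) 0 = (frag_cmul (int k) x, frag_cmul (int k) W)" for k
        by (induction k) (simp_all add: zero_prod_def frag_cmul_distrib)
      have "P (frag_cmul (int N) x) = 0"
        using P_diff_eq_0 [of "frag_cmul (int N) x" 0] N(2) h_closed [of x] by (simp add: h_cmul h_0)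
      moreover have "total_norm (frag_cmul (int N) W) = 0"
        by (rule total_norm_cmul) (simp add: N(1))
      moreover have "ext_norm (frag_cmul (int N) x, frag_cmul (int N) W)
          \<le> P (frag_cmul (int N) x) + total_norm (frag_cmul (int N) W)"
        using ext_norm_le [of "frag_cmul (int N) x" "frag_cmul (int N) W" 0] by (simp add: ext_cost_def)
      ultimately have "Q (((+) (x, W) ^^ N) 0) = 0"
        unfolding pow using Q_le [of "(frag_cmul (int N) x, frag_cmul (int N) W)"]
          Q.nonneg [of "(frag_cmul (int N) x, frag_cmul (int N) W)"] by linarith
      then show "pv_nmul H N u = pv_zero H" unfolding u nmul_H zero_H j by simp
    qed
    show "pv_separable H" if "countable (UNIV :: 'i set)"
    proof (rule separable_extension [OF quot Q_le _ _ that])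
      show "countable (range a)" using that by simp
      show "\<exists>d\<in>range a. P (x - d) < e" if "0 < e" for x e
        using dense [rule_format, OF h_closed that, of x] by (auto simp: P_diff ha)
    qed
  qed
qed

lemma lepoll_into_times_real:
  assumes "countable (UNIV :: 'i set)"
  shows "(UNIV :: ('a \<times> 'i) set) \<lesssim> (UNIV :: ('a \<times> real) set)"
proof -
  have "inj (\<lambda>(x :: 'a, i :: 'i). (x, real (to_nat_on UNIV i)))"
    using inj_on_to_nat_on [OF assms] by (auto intro!: injI dest: injD)
  then show ?thesis unfolding lepoll_def by blast
qed

text \<open>Types cannot be quantified existentially, so the enlargement is produced on the concrete
  type \<open>'a \<times> real\<close>, while the converse is also stated for an arbitrary type
  \<open>'b\<close>.\<close>

theorem theorem9p2:
  fixes G :: "'a pvg"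
  assumes "subnormed_top_pvg G"
  shows "(class_O00 G \<longleftrightarrow>
            (\<exists>(H :: ('a \<times> real) pvg) f. subnormed_pvg H \<and> pv_enlarging G H f \<and>
                pv_dense_in H (pv_E H)))
       \<and> (\<forall>(H :: 'b pvg) f. subnormed_pvg H \<and> pv_enlarging G H f \<and> pv_dense_in H (pv_E H)
              \<longrightarrow> class_O00 G)
       \<and> (\<forall>(r :: ereal) (N :: nat). r \<in> {1, \<infinity>} \<and> N \<noteq> 1 \<and> frakG r N G \<and> class_O00 G \<longrightarrow>
            (\<exists>(H :: ('a \<times> real) pvg) f. subnormed_pvg H \<and> pv_enlarging G H f \<and>
                pv_dense_in H (pv_E H) \<and> frakG r N H))"
proof -
  have G: "subnormed_pvg G" "abelian_group_on G" "is_value G"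
    using assms by (simp_all add: subnormed_top_pvg_def subnormed_pvg_def pseudovector_group_def)
  have dist_self: "pv_dist G x x = 0" if "x \<in> pv_carrier G" for x
    using G(2) that norm_zero_eq_0 [OF G(3,2)] by (simp add: abelian_group_on_def pv_dist_def)
  have only_if: "class_O00 G" if "subnormed_pvg H" "pv_enlarging G H f" "pv_dense_in H (pv_E H)"
    for H :: "'c pvg" and f
    using class_O00_enlarging [OF G(1) that(1,2) class_O00_if_dense] that by blast
  have inv_Suc: "\<exists>m. inverse (real (Suc m)) < e" if "0 < e" for e :: real
    using reals_Archimedean [OF that] .
  have enlarge: "\<exists>(H :: ('a \<times> real) pvg) f. subnormed_pvg H \<and> pv_enlarging G H f \<and> pv_dense_in H (pv_E H)"
    if O00: "class_O00 G"
  proof -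
    \<comment> \<open>Every point of the carrier at every precision \<open>1 / (m + 1)\<close>;
      arguments outside the carrier default to zero.\<close>
    define g where "g = (\<lambda>(x, m :: nat). if x \<in> pv_carrier G then x else pv_zero G)"
    define \<epsilon> where "\<epsilon> = (\<lambda>(x :: 'a, m). inverse (real (Suc m)))"
    have g: "g i \<in> pv_carrier G" for i using G(2) by (simp add: g_def split_beta abelian_group_on_def)
    have \<epsilon>: "0 < \<epsilon> i" for i by (simp add: \<epsilon>_def split_beta)
    have "\<forall>i. \<exists>n>0. \<forall>k. pv_norm G (pv_nmul G (n * k) (g i)) \<le> \<epsilon> i / 2 * real (n * k)"
      by (intro allI small_multiples O00 G g) (simp add: \<epsilon>)
    then obtain \<nu> where \<nu>: "\<And>i. 0 < \<nu> i"
      "\<And>i k. pv_norm G (pv_nmul G (\<nu> i * k) (g i)) \<le> \<epsilon> i / 2 * real (\<nu> i * k)" by metis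
    have dense: "\<forall>x\<in>pv_carrier G. \<forall>e>0. \<exists>i. pv_dist G x (g i) < e \<and> \<epsilon> i < e"
    proof (intro ballI allI impI)
      fix x and e :: real assume x: "x \<in> pv_carrier G" "0 < e"
      obtain m where "inverse (real (Suc m)) < e" using inv_Suc [OF \<open>0 < e\<close>] ..
      then show "\<exists>i. pv_dist G x (g i) < e \<and> \<epsilon> i < e"
        using x dist_self by (intro exI [of _ "(x, m)"]) (simp add: g_def \<epsilon>_def)
    qed
    have "(UNIV :: ('a \<times> nat) set) \<lesssim> (UNIV :: ('a \<times> real) set)"
      by (rule lepoll_into_times_real) simp
    from enlarging_exists [OF assms O00 this g \<epsilon> \<nu> dense]
    show ?thesis by (elim exE conjE) (intro exI conjI)
  qed
  have enlarge_frakG: "\<exists>(H :: ('a \<times> real) pvg) f. subnormed_pvg H \<and> pv_enlarging G H f \<and>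
      pv_dense_in H (pv_E H) \<and> frakG r N H"
    if r: "r \<in> {1, \<infinity>}" and frakG: "frakG r N G" and O00: "class_O00 G" for r N
  proof -
    obtain D where D: "countable D" "pv_dense_in G D"
      using frakG by (auto simp: frakG_def pv_separable_def)
    have "D \<noteq> {}"
      using D(2) G(2) zero_less_one unfolding pv_dense_in_def abelian_group_on_def by blast
    \<comment> \<open>Now only points of a countable dense set, to keep the index type
      countable.\<close>
    define g where "g = (\<lambda>(n, m :: nat). from_nat_into D n)"
    define \<epsilon> where "\<epsilon> = (\<lambda>(n :: nat, m). inverse (real (Suc m)))"
    have g: "g i \<in> pv_carrier G" for i
      using D(2) from_nat_into [OF \<open>D \<noteq> {}\<close>] by (auto simp: g_def split_beta pv_dense_in_def)
    have \<epsilon>: "0 < \<epsilon> i" for i by (simp add: \<epsilon>_def split_beta)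
    \<comment> \<open>For \<open>N \<noteq> 0\<close> all orders are set to \<open>N\<close> to keep
      the exponent; the smallness condition then concerns only the zero element.\<close>
    have "\<forall>i. \<exists>n>0. (N \<noteq> 0 \<longrightarrow> n = N) \<and> (\<forall>k. pv_norm G (pv_nmul G (n * k) (g i)) \<le> \<epsilon> i / 2 * real (n * k))"
    proof (cases "N = 0")
      case True
      have "\<exists>n>0. \<forall>k. pv_norm G (pv_nmul G (n * k) (g i)) \<le> \<epsilon> i / 2 * real (n * k)" for i
        by (intro small_multiples O00 G g) (simp add: \<epsilon>)
      then show ?thesis using True by simp
    next
      case False
      have "pv_nmul G (N * k) (g i) = pv_zero G" for i k
      proof -
        obtain h where "presented_pvg G h" using presented_pvg_exists [OF G(1)] .
        then interpret presented_pvg G h .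
        have "pv_nmul G N (h (frag_cmul (int k) (frag_of (g i)))) = pv_zero G"
          using frakG False h_closed by (simp add: frakG_def)
        then show ?thesis
          using h_cmul [of "N * k" "frag_of (g i)"] h_cmul [of N "frag_cmul (int k) (frag_of (g i))"]
          by (simp add: h_of g)
      qed
      then show ?thesis using False \<epsilon> norm_zero_eq_0 [OF G(3,2)]
        by (intro allI exI [of _ N]) (simp add: less_imp_le)
    qed
    then obtain \<nu> where \<nu>: "\<And>i. 0 < \<nu> i" "\<And>i. N \<noteq> 0 \<Longrightarrow> \<nu> i = N"
      "\<And>i k. pv_norm G (pv_nmul G (\<nu> i * k) (g i)) \<le> \<epsilon> i / 2 * real (\<nu> i * k)" by metis
    have dense: "\<forall>x\<in>pv_carrier G. \<forall>e>0. \<exists>i. pv_dist G x (g i) < e \<and> \<epsilon> i < e"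
    proof (intro ballI allI impI)
      fix x and e :: real assume x: "x \<in> pv_carrier G" "0 < e"
      obtain m where m: "inverse (real (Suc m)) < e" using inv_Suc [OF \<open>0 < e\<close>] ..
      obtain d where "d \<in> D" "pv_dist G x d < e" using D(2) x unfolding pv_dense_in_def by blast
      moreover obtain n where "from_nat_into D n = d"
        using from_nat_into_surj [OF D(1) \<open>d \<in> D\<close>] by blast
      ultimately show "\<exists>i. pv_dist G x (g i) < e \<and> \<epsilon> i < e"
        using m by (intro exI [of _ "(n, m)"]) (simp add: g_def \<epsilon>_def)
    qed
    have card: "(UNIV :: (nat \<times> nat) set) \<lesssim> (UNIV :: ('a \<times> real) set)"
    proof -
      have "inj (\<lambda>i :: nat \<times> nat. (undefined :: 'a, real (to_nat i)))" by (auto intro!: injI)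
      then show ?thesis unfolding lepoll_def by blast
    qed
    obtain H :: "('a \<times> real) pvg" and f where H: "subnormed_pvg H" "pv_enlarging G H f" "pv_dense_in H (pv_E H)"
      and le1: "(\<forall>x\<in>pv_carrier G. pv_norm G x \<le> 1) \<longrightarrow> (\<forall>x\<in>pv_carrier H. pv_norm H x \<le> 1)"
      and exponent: "\<forall>N. (\<forall>i. \<nu> i = N) \<longrightarrow> (\<forall>x\<in>pv_carrier G. pv_nmul G N x = pv_zero G) \<longrightarrow>
        (\<forall>x\<in>pv_carrier H. pv_nmul H N x = pv_zero H)"
      and separable: "countable (UNIV :: (nat \<times> nat) set) \<longrightarrow> pv_separable H"
      using enlarging_exists [OF assms O00 card g \<epsilon> \<nu>(1,3) dense] by (elim exE conjE) (rule that)
    have "valued_abelian_group H"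
      using H(1) by (simp add: valued_abelian_group_def subnormed_pvg_def pseudovector_group_def)
    \<comment> \<open>Density of \<open>pv_E H\<close> implies this, by the easy direction applied
      to \<open>H\<close> itself.\<close>
    moreover have "class_O0 H"
      using class_O00_if_dense [OF H(1,3)] by (simp add: class_O0_def class_O00_def)
    moreover have "\<forall>x\<in>pv_carrier H. ereal (pv_norm H x) \<le> r"
      using r frakG le1 by (auto simp: frakG_def one_ereal_def)
    moreover have "N \<noteq> 0 \<longrightarrow> (\<forall>x\<in>pv_carrier H. pv_nmul H N x = pv_zero H)"
      using frakG \<nu>(2) exponent by (simp add: frakG_def)
    ultimately have "frakG r N H" using separable by (simp add: frakG_def countableI_type)
    with H show ?thesis by (intro exI conjI)
  qed
  show ?thesis
  proof (intro conjI iffI allI impI; (elim exE conjE)?)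
    show "class_O00 G" if "subnormed_pvg H" "pv_enlarging G H f" "pv_dense_in H (pv_E H)"
      for H :: "('a \<times> real) pvg" and f
      using that by (rule only_if)
    show "class_O00 G" if "subnormed_pvg H" "pv_enlarging G H f" "pv_dense_in H (pv_E H)"
      for H :: "'b pvg" and f
      using that by (rule only_if)
  qed (rule enlarge enlarge_frakG; assumption)+
qed

end
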